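(* The assignment $\mathcal{L}$ of linear open systems to linearly typed boxes and wiring diagrams, together with the coherence maps $\mu_{\mathbf{Lin}}$ (both defined in the context), is a lax monoidal functor $(\mathcal{L},\mu_{\mathbf{Lin}})\colon(\mathbf{W}_{\mathbf{Lin}},\oplus,0)\to(\mathbf{Set},\times,\star)$; that is, $\mathcal{L}$ is a $\mathbf{W}_{\mathbf{Lin}}$-algebra.
   Context: $\mathbf{Lin}$ is the category of Euclidean spaces $\mathbb{R}^n$, $n\in\mathbb{N}$, and linear maps; it has finite products. $(\mathbf{Set},\times,\star)$ is sets with cartesian product and one-point set $\star$. For a symmetric monoidal category $\mathcal{C}$, a $\mathcal{C}$-algebra is a lax monoidal functor $\mathcal{C}\to\mathbf{Set}$. **Typed finite sets.** $\mathbf{TFS}_{\mathbf{Lin}}$ is the category whose objects are pairs $(A,\tau)$ with $A$ a finite set and $\tau\colon A\to \mathrm{Ob}\,\mathbf{Lin}$, and whose morphisms $(A,\tau)\to(A',\tau')$ (typed functions) are functions $q\colon A\to A'$ with $\tau'\circ q=\tau$. It has finite coproducts $+$ (disjoint union); $\nabla$ is the codiagonal and $\mathbb{1}$ denotes identities. The dependent product of $(A,\tau)$ is $\overline{A}:=\prod_{a\in A}\tau(a)\in\mathbf{Lin}$; a typed function $q\colon A\to A'$ induces the linear map $\overline{q}\colon\overline{A'}\to\overline{A}$, $(x_{a'})_{a'\in A'}\mapsto(x_{q(a)})_{a\in A}$. Canonically $\overline{A+B}\cong\overline{A}\times\overline{B}$. **The symmetric monoidal category $\mathbf{W}_{\mathbf{Lin}}$.**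 Objects (boxes) are ordered pairs $X=(X^{\mathrm{in}},X^{\mathrm{out}})$ of objects of $\mathbf{TFS}_{\mathbf{Lin}}$. A morphism (wiring diagram) $\Phi\colon X\to Y$ is a triple $(X,Y,\varphi)$ with $\varphi\colon X^{\mathrm{in}}+Y^{\mathrm{out}}\xrightarrow{\cong}X^{\mathrm{out}}+Y^{\mathrm{in}}$ a typed bijection such that $\varphi(Y^{\mathrm{out}})\subseteq X^{\mathrm{out}}$; equivalently $\varphi$ is given by its restrictions $\varphi^{\mathrm{in}}\colon X^{\mathrm{in}}\to X^{\mathrm{out}}+Y^{\mathrm{in}}$ and $\varphi^{\mathrm{out}}\colon Y^{\mathrm{out}}\to X^{\mathrm{out}}$. The identity of $X$ is the identity map of $X^{\mathrm{in}}+X^{\mathrm{out}}$. The composite of $\Phi=(X,Y,\varphi)$ and $\Psi=(Y,Z,\psi)$ is $(X,Z,\omega)$ with $\omega^{\mathrm{out}}=\varphi^{\mathrm{out}}\circ\psi^{\mathrm{out}}$ and $$\omega^{\mathrm{in}}=(\nabla+\mathbb{1}_{Z^{\mathrm{in}}})\circ(\mathbb{1}_{X^{\mathrm{out}}}+\varphi^{\mathrm{out}}+\mathbb{1}_{Z^{\mathrm{in}}})\circ(\mathbb{1}_{X^{\mathrm{out}}}+\psi^{\mathrm{in}})\circ\varphi^{\mathrm{in}}.$$ The monoidal product is $X_1\oplus X_2=(X_1^{\mathrm{in}}+X_2^{\mathrm{in}},X_1^{\mathrm{out}}+X_2^{\mathrm{out}})$ on boxes and $\varphi_1+\varphi_2$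 on wiring diagrams; the unit is $0=(\varnothing,\varnothing)$. Applying the dependent product to $\varphi$ gives a linear isomorphism $\overline{\varphi}\colon\overline{X^{\mathrm{out}}}\times\overline{Y^{\mathrm{in}}}\to\overline{X^{\mathrm{in}}}\times\overline{Y^{\mathrm{out}}}$, written as a block matrix $$\overline{\varphi}=\begin{bmatrix}\overline{\varphi}^{X,X}&\overline{\varphi}^{X,Y}\\ \overline{\varphi}^{Y,X}&\overline{\varphi}^{Y,Y}\end{bmatrix},\quad \overline{\varphi}^{X,X}\colon\overline{X^{\mathrm{out}}}\to\overline{X^{\mathrm{in}}},\ \ \overline{\varphi}^{X,Y}\colon\overline{Y^{\mathrm{in}}}\to\overline{X^{\mathrm{in}}},\ \ \overline{\varphi}^{Y,X}\colon\overline{X^{\mathrm{out}}}\to\overline{Y^{\mathrm{out}}},\ \ \overline{\varphi}^{Y,Y}\colon\overline{Y^{\mathrm{in}}}\to\overline{Y^{\mathrm{out}}},$$ where $\overline{\varphi}^{Y,Y}=0$ because $\varphi(Y^{\mathrm{out}})\subseteq X^{\mathrm{out}}$. **Linear open systems.** An open system is a tuple $(M,U^{\mathrm{in}},U^{\mathrm{out}},f)$ with $f=(f^{\mathrm{in}},f^{\mathrm{out}})$, $f^{\mathrm{in}}\colon M\times U^{\mathrm{in}}\to TM$, $f^{\mathrm{out}}\colon M\to U^{\mathrm{out}}$ smooth and $f^{\mathrm{in}}(m,u)\in T_mM$. It is linear if $M,U^{\mathrm{in}},U^{\mathrm{out}}$ are Euclidean spaces and $f^{\mathrm{in}},f^{\mathrm{out}}$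 are linear. Identifying each $T_mM$ with $M$, a linear open system amounts to linear maps $f^{M,M}\colon M\to M$, $f^{M,U}\colon U^{\mathrm{in}}\to M$, $f^{U,M}\colon M\to U^{\mathrm{out}}$, organized as $$\begin{bmatrix}\dot m\\ u^{\mathrm{out}}\end{bmatrix}=\begin{bmatrix}f^{M,M}&f^{M,U}\\ f^{U,M}&0\end{bmatrix}\begin{bmatrix}m\\ u^{\mathrm{in}}\end{bmatrix},$$ where $\dot m$ is the tangent-vector component of $f^{\mathrm{in}}(m,u^{\mathrm{in}})\in T_mM$. **Definition of $(\mathcal{L},\mu_{\mathbf{Lin}})$.** For $X\in\mathrm{Ob}\,\mathbf{W}_{\mathbf{Lin}}$, $$\mathcal{L}(X)=\{(S,f)\mid S\in\mathrm{Ob}\,\mathbf{TFS}_{\mathbf{Lin}},\ (\overline{S},\overline{X^{\mathrm{in}}},\overline{X^{\mathrm{out}}},f)\text{ is a linear open system}\},$$ and the blocks of such $f$ are written $f^{S,S}\colon\overline S\to\overline S$, $f^{S,X}\colon\overline{X^{\mathrm{in}}}\to\overline S$, $f^{X,S}\colon\overline S\to\overline{X^{\mathrm{out}}}$. For $\Phi=(X,Y,\varphi)$, $\mathcal{L}(\Phi)(S,f)=(S,g)$ where $$\begin{bmatrix}g^{S,S}&g^{S,Y}\\ g^{Y,S}&g^{Y,Y}\end{bmatrix}=\begin{bmatrix}f^{S,X}&0\\0&I\end{bmatrix}\overline{\varphi}\begin{bmatrix}f^{X,S}&0\\0&I\end{bmatrix}+\begin{bmatrix}f^{S,S}&0\\0&0\end{bmatrix}=\begin{bmatrix}f^{S,X}\overline{\varphi}^{X,X}f^{X,S}+f^{S,S}&f^{S,X}\overline{\varphi}^{X,Y}\\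 \overline{\varphi}^{Y,X}f^{X,S}&0\end{bmatrix}.$$ The coherence map $\mathcal{L}(X)\times\mathcal{L}(X')\to\mathcal{L}(X\oplus X')$ is $((S,f),(S',f'))\mapsto(S+S',f\times f')$, where $f\times f'$ is the product system: its state, input and output spaces are the products, and each of its blocks is the direct sum of the corresponding blocks of $f$ and $f'$. The unit map $\star\to\mathcal{L}(0)$ picks out the trivial system with $S=\varnothing$. Convention: size issues are ignored, and the canonical associativity, unit and symmetry isomorphisms of finite coproducts of typed finite sets (and of the corresponding products of Euclidean spaces) are treated as equalities. *)

theory Defs
  imports "Jordan_Normal_Form.Matrix" "HOL-Library.FuncSet"
begin

section \<open>Monoidal categories and lax monoidal functors to sets\<close>

locale small_category =
  fixes Obj :: "'o set"
    and Hom :: "'o \<Rightarrow> 'o \<Rightarrow> 'm set"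
    and Id :: "'o \<Rightarrow> 'm"
    and Comp :: "'m \<Rightarrow> 'm \<Rightarrow> 'm"  (infixl "\<cdot>" 70)
  assumes Hom_disjoint: "\<lbrakk>A \<in> Obj; B \<in> Obj; A' \<in> Obj; B' \<in> Obj; f \<in> Hom A B; f \<in> Hom A' B'\<rbrakk>
      \<Longrightarrow> A = A' \<and> B = B'"
    and Id_in: "A \<in> Obj \<Longrightarrow> Id A \<in> Hom A A"
    and Comp_in: "\<lbrakk>A \<in> Obj; B \<in> Obj; C \<in> Obj; f \<in> Hom A B; g \<in> Hom B C\<rbrakk> \<Longrightarrow> g \<cdot> f \<in> Hom A C"
    and Id_right: "\<lbrakk>A \<in> Obj; B \<in> Obj; f \<in> Hom A B\<rbrakk> \<Longrightarrow> f \<cdot> Id A = f"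
    and Id_left: "\<lbrakk>A \<in> Obj; B \<in> Obj; f \<in> Hom A B\<rbrakk> \<Longrightarrow> Id B \<cdot> f = f"
    and Comp_assoc: "\<lbrakk>A \<in> Obj; B \<in> Obj; C \<in> Obj; D \<in> Obj; f \<in> Hom A B; g \<in> Hom B C; h \<in> Hom C D\<rbrakk>
      \<Longrightarrow> (h \<cdot> g) \<cdot> f = h \<cdot> (g \<cdot> f)"
begin

definition iso_arrow :: "'o \<Rightarrow> 'o \<Rightarrow> 'm \<Rightarrow> bool" where
  "iso_arrow A B f \<longleftrightarrow> f \<in> Hom A B \<and> (\<exists>g \<in> Hom B A. g \<cdot> f = Id A \<and> f \<cdot> g = Id B)"

end

locale monoidal_category = small_category Obj Hom Id Comp
  for Obj :: "'o set" and Hom :: "'o \<Rightarrow> 'o \<Rightarrow> 'm set" and Id :: "'o \<Rightarrow> 'm"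
    and Comp :: "'m \<Rightarrow> 'm \<Rightarrow> 'm"  (infixl "\<cdot>" 70) +
  fixes TenO :: "'o \<Rightarrow> 'o \<Rightarrow> 'o"  (infixr "\<odot>" 75)
    and TenM :: "'m \<Rightarrow> 'm \<Rightarrow> 'm"  (infixr "\<star>" 75)
    and I :: 'o
    and assoc :: "'o \<Rightarrow> 'o \<Rightarrow> 'o \<Rightarrow> 'm"
    and lunit :: "'o \<Rightarrow> 'm"
    and runit :: "'o \<Rightarrow> 'm"
  assumes I_in: "I \<in> Obj"
    and TenO_in: "\<lbrakk>A \<in> Obj; B \<in> Obj\<rbrakk> \<Longrightarrow> A \<odot> B \<in> Obj"
    and TenM_in: "\<lbrakk>A \<in> Obj; B \<in> Obj; A' \<in> Obj; B' \<in> Obj; f \<in> Hom A B; f' \<in> Hom A' B'\<rbrakk>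
      \<Longrightarrow> f \<star> f' \<in> Hom (A \<odot> A') (B \<odot> B')"
    and TenM_Id: "\<lbrakk>A \<in> Obj; B \<in> Obj\<rbrakk> \<Longrightarrow> Id A \<star> Id B = Id (A \<odot> B)"
    and interchange: "\<lbrakk>A \<in> Obj; B \<in> Obj; C \<in> Obj; A' \<in> Obj; B' \<in> Obj; C' \<in> Obj;
        f \<in> Hom A B; g \<in> Hom B C; f' \<in> Hom A' B'; g' \<in> Hom B' C'\<rbrakk>
      \<Longrightarrow> (g \<cdot> f) \<star> (g' \<cdot> f') = (g \<star> g') \<cdot> (f \<star> f')"
    and assoc_iso: "\<lbrakk>A \<in> Obj; B \<in> Obj; C \<in> Obj\<rbrakk>
      \<Longrightarrow> iso_arrow ((A \<odot> B) \<odot> C) (A \<odot> (B \<odot> C)) (assoc A B C)"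
    and assoc_nat: "\<lbrakk>A \<in> Obj; B \<in> Obj; C \<in> Obj; A' \<in> Obj; B' \<in> Obj; C' \<in> Obj;
        f \<in> Hom A A'; g \<in> Hom B B'; h \<in> Hom C C'\<rbrakk>
      \<Longrightarrow> assoc A' B' C' \<cdot> ((f \<star> g) \<star> h) = (f \<star> (g \<star> h)) \<cdot> assoc A B C"
    and lunit_iso: "A \<in> Obj \<Longrightarrow> iso_arrow (I \<odot> A) A (lunit A)"
    and lunit_nat: "\<lbrakk>A \<in> Obj; B \<in> Obj; f \<in> Hom A B\<rbrakk> \<Longrightarrow> lunit B \<cdot> (Id I \<star> f) = f \<cdot> lunit A"
    and runit_iso: "A \<in> Obj \<Longrightarrow> iso_arrow (A \<odot> I) A (runit A)"
    and runit_nat: "\<lbrakk>A \<in> Obj; B \<in> Obj; f \<in> Hom A B\<rbrakk> \<Longrightarrow> runit B \<cdot> (f \<star> Id I) = f \<cdot> runit A"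
    and pentagon: "\<lbrakk>A \<in> Obj; B \<in> Obj; C \<in> Obj; D \<in> Obj\<rbrakk>
      \<Longrightarrow> (Id A \<star> assoc B C D) \<cdot> assoc A (B \<odot> C) D \<cdot> (assoc A B C \<star> Id D)
        = assoc A B (C \<odot> D) \<cdot> assoc (A \<odot> B) C D"
    and triangle: "\<lbrakk>A \<in> Obj; B \<in> Obj\<rbrakk>
      \<Longrightarrow> (Id A \<star> lunit B) \<cdot> assoc A I B = runit A \<star> Id B"

locale symmetric_monoidal_category =
  monoidal_category Obj Hom Id Comp TenO TenM I assoc lunit runit
  for Obj :: "'o set" and Hom :: "'o \<Rightarrow> 'o \<Rightarrow> 'm set" and Id :: "'o \<Rightarrow> 'm"
    and Comp :: "'m \<Rightarrow> 'm \<Rightarrow> 'm"  (infixl "\<cdot>" 70)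
    and TenO :: "'o \<Rightarrow> 'o \<Rightarrow> 'o"  (infixr "\<odot>" 75)
    and TenM :: "'m \<Rightarrow> 'm \<Rightarrow> 'm"  (infixr "\<star>" 75)
    and I :: 'o and assoc :: "'o \<Rightarrow> 'o \<Rightarrow> 'o \<Rightarrow> 'm"
    and lunit :: "'o \<Rightarrow> 'm" and runit :: "'o \<Rightarrow> 'm" +
  fixes braid :: "'o \<Rightarrow> 'o \<Rightarrow> 'm"
  assumes braid_in: "\<lbrakk>A \<in> Obj; B \<in> Obj\<rbrakk> \<Longrightarrow> braid A B \<in> Hom (A \<odot> B) (B \<odot> A)"
    and braid_inv: "\<lbrakk>A \<in> Obj; B \<in> Obj\<rbrakk> \<Longrightarrow> braid B A \<cdot> braid A B = Id (A \<odot> B)"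
    and braid_nat: "\<lbrakk>A \<in> Obj; B \<in> Obj; A' \<in> Obj; B' \<in> Obj; f \<in> Hom A A'; g \<in> Hom B B'\<rbrakk>
      \<Longrightarrow> braid A' B' \<cdot> (f \<star> g) = (g \<star> f) \<cdot> braid A B"
    and hexagon: "\<lbrakk>A \<in> Obj; B \<in> Obj; C \<in> Obj\<rbrakk>
      \<Longrightarrow> assoc B C A \<cdot> braid A (B \<odot> C) \<cdot> assoc A B C
        = (Id B \<star> braid A C) \<cdot> assoc B A C \<cdot> (braid A B \<star> Id C)"

text \<open>A lax monoidal functor to (Set, cartesian product, one-point set).  The sets are the carriers
  \<open>F0 A\<close> inside a type, equality of maps of sets is equality on the carriers, and the unit map
  out of the one-point set is the element \<open>unit\<close>.\<close>

locale lax_monoidal_functor_to_Set =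
  monoidal_category Obj Hom Id Comp TenO TenM I assoc lunit runit
  for Obj :: "'o set" and Hom :: "'o \<Rightarrow> 'o \<Rightarrow> 'm set" and Id :: "'o \<Rightarrow> 'm"
    and Comp :: "'m \<Rightarrow> 'm \<Rightarrow> 'm"  (infixl "\<cdot>" 70)
    and TenO :: "'o \<Rightarrow> 'o \<Rightarrow> 'o"  (infixr "\<odot>" 75)
    and TenM :: "'m \<Rightarrow> 'm \<Rightarrow> 'm"  (infixr "\<star>" 75)
    and I :: 'o and assoc :: "'o \<Rightarrow> 'o \<Rightarrow> 'o \<Rightarrow> 'm"
    and lunit :: "'o \<Rightarrow> 'm" and runit :: "'o \<Rightarrow> 'm" +
  fixes F0 :: "'o \<Rightarrow> 's set"
    and F1 :: "'m \<Rightarrow> 's \<Rightarrow> 's"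
    and mu :: "'o \<Rightarrow> 'o \<Rightarrow> 's \<times> 's \<Rightarrow> 's"
    and unit :: 's
  assumes F1_in: "\<lbrakk>A \<in> Obj; B \<in> Obj; f \<in> Hom A B\<rbrakk> \<Longrightarrow> F1 f \<in> F0 A \<rightarrow> F0 B"
    and F1_Id: "\<lbrakk>A \<in> Obj; s \<in> F0 A\<rbrakk> \<Longrightarrow> F1 (Id A) s = s"
    and F1_Comp: "\<lbrakk>A \<in> Obj; B \<in> Obj; C \<in> Obj; f \<in> Hom A B; g \<in> Hom B C; s \<in> F0 A\<rbrakk>
      \<Longrightarrow> F1 (g \<cdot> f) s = F1 g (F1 f s)"
    and mu_in: "\<lbrakk>A \<in> Obj; B \<in> Obj\<rbrakk> \<Longrightarrow> mu A B \<in> F0 A \<times> F0 B \<rightarrow> F0 (A \<odot> B)"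
    and unit_in: "unit \<in> F0 I"
    and mu_nat: "\<lbrakk>A \<in> Obj; B \<in> Obj; A' \<in> Obj; B' \<in> Obj; f \<in> Hom A A'; g \<in> Hom B B';
        s \<in> F0 A; t \<in> F0 B\<rbrakk>
      \<Longrightarrow> F1 (f \<star> g) (mu A B (s, t)) = mu A' B' (F1 f s, F1 g t)"
    and mu_assoc: "\<lbrakk>A \<in> Obj; B \<in> Obj; C \<in> Obj; s \<in> F0 A; t \<in> F0 B; u \<in> F0 C\<rbrakk>
      \<Longrightarrow> F1 (assoc A B C) (mu (A \<odot> B) C (mu A B (s, t), u)) = mu A (B \<odot> C) (s, mu B C (t, u))"
    and mu_lunit: "\<lbrakk>A \<in> Obj; s \<in> F0 A\<rbrakk> \<Longrightarrow> F1 (lunit A) (mu I A (unit, s)) = s"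
    and mu_runit: "\<lbrakk>A \<in> Obj; s \<in> F0 A\<rbrakk> \<Longrightarrow> F1 (runit A) (mu A I (s, unit)) = s"

text \<open>A \<open>C\<close>-algebra: a lax monoidal functor to Set whose source \<open>C\<close> is symmetric monoidal.\<close>

locale monoidal_algebra =
  symmetric_monoidal_category Obj Hom Id Comp TenO TenM I assoc lunit runit braid +
  lax_monoidal_functor_to_Set Obj Hom Id Comp TenO TenM I assoc lunit runit F0 F1 mu unit
  for Obj :: "'o set" and Hom :: "'o \<Rightarrow> 'o \<Rightarrow> 'm set" and Id :: "'o \<Rightarrow> 'm"
    and Comp :: "'m \<Rightarrow> 'm \<Rightarrow> 'm"
    and TenO :: "'o \<Rightarrow> 'o \<Rightarrow> 'o" and TenM :: "'m \<Rightarrow> 'm \<Rightarrow> 'm"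
    and I :: 'o and assoc :: "'o \<Rightarrow> 'o \<Rightarrow> 'o \<Rightarrow> 'm"
    and lunit :: "'o \<Rightarrow> 'm" and runit :: "'o \<Rightarrow> 'm" and braid :: "'o \<Rightarrow> 'o \<Rightarrow> 'm"
    and F0 :: "'o \<Rightarrow> 's set" and F1 :: "'m \<Rightarrow> 's \<Rightarrow> 's"
    and mu :: "'o \<Rightarrow> 'o \<Rightarrow> 's \<times> 's \<Rightarrow> 's" and unit :: 's


section \<open>Typed finite sets\<close>

text \<open>A typed finite set \<open>(A, \<tau>)\<close> assigns to \<open>a \<in> A\<close> the Euclidean space of dimension \<open>\<tau> a\<close>.
  Typings, and functions on sets generally, are extensional (\<open>undefined\<close> off their domain), so
  that HOL equality is equality of maps.\<close>

type_synonym 'i tfs = "'i set \<times> ('i \<Rightarrow> nat)"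

definition TFS :: "'i tfs set" where
  "TFS = {(A, \<tau>). finite A \<and> \<tau> \<in> extensional A}"

definition TFS_hom :: "'i tfs \<Rightarrow> 'j tfs \<Rightarrow> ('i \<Rightarrow> 'j) set" where
  "TFS_hom A B = {q \<in> fst A \<rightarrow>\<^sub>E fst B. \<forall>a \<in> fst A. snd B (q a) = snd A a}"

text \<open>There are two models of the coproduct.  \<open>A +\<^sub>T B\<close> uses the sum type, and serves as domain and
  codomain of the bijections in wiring diagrams.  Boxes and state spaces need a coproduct inside a
  fixed type: their elements are labels with a numerical tag, and \<open>A \<uplus>\<^sub>T B\<close> is the union of \<open>A\<close> with
  a copy of \<open>B\<close> whose tags are shifted past those of \<open>A\<close>.  For example, \<open>A \<times> {0} \<uplus>\<^sub>T B \<times> {0}\<close> has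
  underlying set \<open>A \<times> {0} \<union> B \<times> {1}\<close> when \<open>A\<close> is nonempty.  In this model the canonical
  associativity and unit isomorphisms are identities.\<close>

definition TFS_plus :: "'i tfs \<Rightarrow> 'j tfs \<Rightarrow> ('i + 'j) tfs"  (infixr "+\<^sub>T" 65) where
  "A +\<^sub>T B = (fst A <+> fst B, case_sum (snd A) (snd B))"

type_synonym 'a label = "'a \<times> nat"

definition height :: "'a label set \<Rightarrow> nat" where
  "height A = (SUP a \<in> A. Suc (snd a))"

text \<open>\<open>join A\<close> and \<open>split A\<close> are the mutually inverse bijections between \<open>A <+> B\<close> and the
  underlying set of \<open>A \<uplus>\<^sub>T B\<close>.\<close>

definition join :: "'a label set \<Rightarrow> 'a label + 'a label \<Rightarrow> 'a label" where
  "join A z = (case z of Inl a \<Rightarrow> a | Inr b \<Rightarrow> (fst b, height A + snd b))"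

definition split :: "'a label set \<Rightarrow> 'a label \<Rightarrow> 'a label + 'a label" where
  "split A c = (if snd c < height A then Inl c else Inr (fst c, snd c - height A))"

definition TFS_union :: "'a label tfs \<Rightarrow> 'a label tfs \<Rightarrow> 'a label tfs"  (infixr "\<uplus>\<^sub>T" 65) where
  "A \<uplus>\<^sub>T B = (let C = join (fst A) ` (fst A <+> fst B)
     in (C, \<lambda>c \<in> C. case_sum (snd A) (snd B) (split (fst A) c)))"

definition TFS_empty :: "'i tfs" where
  "TFS_empty = ({}, \<lambda>_. undefined)"


section \<open>Linear maps and dependent products\<close>

definition linear_maps :: "(real, 'v) module \<Rightarrow> (real, 'w) module \<Rightarrow> ('v \<Rightarrow> 'w) set" where
  "linear_maps V W = {h \<in> carrier V \<rightarrow>\<^sub>E carrier W.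
     (\<forall>x \<in> carrier V. \<forall>y \<in> carrier V. h (x \<oplus>\<^bsub>V\<^esub> y) = h x \<oplus>\<^bsub>W\<^esub> h y) \<and>
     (\<forall>c. \<forall>x \<in> carrier V. h (c \<odot>\<^bsub>V\<^esub> x) = c \<odot>\<^bsub>W\<^esub> h x)}"

definition direct_product :: "(real, 'v) module \<Rightarrow> (real, 'w) module \<Rightarrow> (real, 'v \<times> 'w) module"
    (infixr "\<times>\<^sub>V" 65) where
  "V \<times>\<^sub>V W = \<lparr>carrier = carrier V \<times> carrier W, mult = undefined, one = undefined,
     zero = (\<zero>\<^bsub>V\<^esub>, \<zero>\<^bsub>W\<^esub>),
     add = (\<lambda>x y. (fst x \<oplus>\<^bsub>V\<^esub> fst y, snd x \<oplus>\<^bsub>W\<^esub> snd y)),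
     smult = (\<lambda>c x. (c \<odot>\<^bsub>V\<^esub> fst x, c \<odot>\<^bsub>W\<^esub> snd x))\<rparr>"

text \<open>The dependent product of the Euclidean spaces \<open>carrier_vec (\<tau> a)\<close>, for \<open>a \<in> A\<close>.\<close>

definition dprod :: "'i tfs \<Rightarrow> (real, 'i \<Rightarrow> real vec) module" where
  "dprod A = \<lparr>carrier = (\<Pi>\<^sub>E a \<in> fst A. carrier_vec (snd A a)),
     mult = undefined, one = undefined,
     zero = (\<lambda>a \<in> fst A. 0\<^sub>v (snd A a)),
     add = (\<lambda>x y. \<lambda>a \<in> fst A. x a + y a),
     smult = (\<lambda>c x. \<lambda>a \<in> fst A. c \<cdot>\<^sub>v x a)\<rparr>"

definition reindex :: "'i tfs \<Rightarrow> 'j tfs \<Rightarrow> ('i \<Rightarrow> 'j) \<Rightarrow> ('j \<Rightarrow> real vec) \<Rightarrow> 'i \<Rightarrow> real vec" where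
  "reindex A B q = (\<lambda>x \<in> carrier (dprod B). \<lambda>a \<in> fst A. x (q a))"


section \<open>Boxes and wiring diagrams\<close>

type_synonym 'a box = "'a label tfs \<times> 'a label tfs"

abbreviation inp :: "'a box \<Rightarrow> 'a label tfs" where "inp X \<equiv> fst X"
abbreviation outp :: "'a box \<Rightarrow> 'a label tfs" where "outp X \<equiv> snd X"

type_synonym 'a wiring = "'a label + 'a label \<Rightarrow> 'a label + 'a label"
type_synonym 'a wd = "'a box \<times> 'a box \<times> 'a wiring"

definition W_Obj :: "'a box set" where
  "W_Obj = TFS \<times> TFS"

definition W_Hom :: "'a box \<Rightarrow> 'a box \<Rightarrow> 'a wd set" where
  "W_Hom X Y = {(X, Y, \<phi>) | \<phi>.
     \<phi> \<in> TFS_hom (inp X +\<^sub>T outp Y) (outp X +\<^sub>T inp Y) \<and>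
     bij_betw \<phi> (fst (inp X +\<^sub>T outp Y)) (fst (outp X +\<^sub>T inp Y)) \<and>
     \<phi> ` Inr ` fst (outp Y) \<subseteq> Inl ` fst (outp X)}"

definition wire_in :: "'a wiring \<Rightarrow> 'a label \<Rightarrow> 'a label + 'a label" where
  "wire_in \<phi> a = \<phi> (Inl a)"

definition wire_out :: "'a wiring \<Rightarrow> 'a label \<Rightarrow> 'a label" where
  "wire_out \<phi> b = projl (\<phi> (Inr b))"

text \<open>The identity on \<open>X\<^sup>i\<^sup>n + X\<^sup>o\<^sup>u\<^sup>t\<close>, followed by the symmetry to \<open>X\<^sup>o\<^sup>u\<^sup>t + X\<^sup>i\<^sup>n\<close>.\<close>

definition W_Id :: "'a box \<Rightarrow> 'a wd" where
  "W_Id X = (X, X, \<lambda>z \<in> fst (inp X +\<^sub>T outp X). case_sum Inr Inl z)"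

definition codiag :: "'x + 'x \<Rightarrow> 'x" where
  "codiag = case_sum id id"

definition sum_assoc :: "'x + ('y + 'z) \<Rightarrow> ('x + 'y) + 'z" where
  "sum_assoc = case_sum (Inl \<circ> Inl) (case_sum (Inl \<circ> Inr) Inr)"

definition W_Comp :: "'a wd \<Rightarrow> 'a wd \<Rightarrow> 'a wd" where
  "W_Comp = (\<lambda>(Y', Z, \<psi>) (X, Y, \<phi>).
     (X, Z, \<lambda>z \<in> fst (inp X +\<^sub>T outp Z).
        case_sum
          (map_sum codiag id \<circ> map_sum (map_sum id (wire_out \<phi>)) id \<circ> sum_assoc
             \<circ> map_sum id (wire_in \<psi>) \<circ> wire_in \<phi>)
          (Inl \<circ> wire_out \<phi> \<circ> wire_out \<psi>) z))"

definition W_sum :: "'a box \<Rightarrow> 'a box \<Rightarrow> 'a box"  (infixr "\<oplus>\<^sub>W" 65) where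
  "X \<oplus>\<^sub>W X' = (inp X \<uplus>\<^sub>T inp X', outp X \<uplus>\<^sub>T outp X')"

definition W_zero :: "'a box" where
  "W_zero = (TFS_empty, TFS_empty)"

definition sum_middle :: "('w + 'x) + ('y + 'z) \<Rightarrow> ('w + 'y) + ('x + 'z)" where
  "sum_middle = case_sum (map_sum Inl Inl) (map_sum Inr Inr)"

text \<open>\<open>\<phi>\<^sub>1 + \<phi>\<^sub>2\<close>, conjugated by the canonical isomorphisms that rearrange the summands.\<close>

definition W_sum_hom :: "'a wd \<Rightarrow> 'a wd \<Rightarrow> 'a wd" where
  "W_sum_hom = (\<lambda>(X1, Y1, \<phi>1) (X2, Y2, \<phi>2).
     (X1 \<oplus>\<^sub>W X2, Y1 \<oplus>\<^sub>W Y2,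
      \<lambda>z \<in> fst (inp (X1 \<oplus>\<^sub>W X2) +\<^sub>T outp (Y1 \<oplus>\<^sub>W Y2)).
        (map_sum (join (fst (outp X1))) (join (fst (inp Y1))) \<circ> sum_middle
          \<circ> map_sum \<phi>1 \<phi>2 \<circ> sum_middle
          \<circ> map_sum (split (fst (inp X1))) (split (fst (outp Y1)))) z))"

text \<open>Since \<open>\<uplus>\<^sub>T\<close> is strictly associative and unital, the structure isomorphisms are identities.\<close>

definition W_assoc :: "'a box \<Rightarrow> 'a box \<Rightarrow> 'a box \<Rightarrow> 'a wd" where
  "W_assoc X Y Z = W_Id (X \<oplus>\<^sub>W Y \<oplus>\<^sub>W Z)"

definition W_unitor :: "'a box \<Rightarrow> 'a wd" where
  "W_unitor X = W_Id X"

definition label_swap :: "'a label tfs \<Rightarrow> 'a label tfs \<Rightarrow> 'a label \<Rightarrow> 'a label" where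
  "label_swap A B c = join (fst B) (case_sum Inr Inl (split (fst A) c))"

definition W_braid :: "'a box \<Rightarrow> 'a box \<Rightarrow> 'a wd" where
  "W_braid X Y = (X \<oplus>\<^sub>W Y, Y \<oplus>\<^sub>W X,
     \<lambda>z \<in> fst (inp (X \<oplus>\<^sub>W Y) +\<^sub>T outp (Y \<oplus>\<^sub>W X)).
       case_sum (Inr \<circ> label_swap (inp X) (inp Y)) (Inl \<circ> label_swap (outp Y) (outp X)) z)"

text \<open>The linear isomorphism induced by \<open>\<phi>\<close>, transported along the canonical isomorphisms between
  the dependent product of \<open>A +\<^sub>T B\<close> and the product of those of \<open>A\<close> and \<open>B\<close>; then its blocks.\<close>

definition wire_lin :: "'a wd \<Rightarrow> ('a label \<Rightarrow> real vec) \<times> ('a label \<Rightarrow> real vec)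
    \<Rightarrow> ('a label \<Rightarrow> real vec) \<times> ('a label \<Rightarrow> real vec)" where
  "wire_lin = (\<lambda>(X, Y, \<phi>) (x, y).
     let z = reindex (inp X +\<^sub>T outp Y) (outp X +\<^sub>T inp Y) \<phi> (case_sum x y)
     in (z \<circ> Inl, z \<circ> Inr))"

definition wire_XX :: "'a wd \<Rightarrow> ('a label \<Rightarrow> real vec) \<Rightarrow> 'a label \<Rightarrow> real vec" where
  "wire_XX = (\<lambda>(X, Y, \<phi>) x. fst (wire_lin (X, Y, \<phi>) (x, \<zero>\<^bsub>dprod (inp Y)\<^esub>)))"

definition wire_XY :: "'a wd \<Rightarrow> ('a label \<Rightarrow> real vec) \<Rightarrow> 'a label \<Rightarrow> real vec" where
  "wire_XY = (\<lambda>(X, Y, \<phi>) y. fst (wire_lin (X, Y, \<phi>) (\<zero>\<^bsub>dprod (outp X)\<^esub>, y)))"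

definition wire_YX :: "'a wd \<Rightarrow> ('a label \<Rightarrow> real vec) \<Rightarrow> 'a label \<Rightarrow> real vec" where
  "wire_YX = (\<lambda>(X, Y, \<phi>) x. snd (wire_lin (X, Y, \<phi>) (x, \<zero>\<^bsub>dprod (inp Y)\<^esub>)))"


section \<open>Linear open systems\<close>

text \<open>The tangent bundle of a Euclidean space \<open>M\<close> is \<open>M \<times>\<^sub>V M\<close>, with the base point as first
  component.  Smoothness is not a separate condition: linear maps between Euclidean spaces are
  smooth.\<close>

type_synonym ('m, 'u, 'w) open_sys = "('m \<times> 'u \<Rightarrow> 'm \<times> 'm) \<times> ('m \<Rightarrow> 'w)"

definition linear_open_system ::
  "(real, 'm) module \<Rightarrow> (real, 'u) module \<Rightarrow> (real, 'w) module \<Rightarrow> ('m, 'u, 'w) open_sys \<Rightarrow> bool" where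
  "linear_open_system M U W f \<longleftrightarrow>
     fst f \<in> linear_maps (M \<times>\<^sub>V U) (M \<times>\<^sub>V M) \<and>
     snd f \<in> linear_maps M W \<and>
     (\<forall>m \<in> carrier M. \<forall>u \<in> carrier U. fst (fst f (m, u)) = m)"

definition block_MM :: "(real, 'm) module \<Rightarrow> (real, 'u) module \<Rightarrow> ('m, 'u, 'w) open_sys \<Rightarrow> 'm \<Rightarrow> 'm" where
  "block_MM M U f m = snd (fst f (m, \<zero>\<^bsub>U\<^esub>))"

definition block_MU :: "(real, 'm) module \<Rightarrow> (real, 'u) module \<Rightarrow> ('m, 'u, 'w) open_sys \<Rightarrow> 'u \<Rightarrow> 'm" where
  "block_MU M U f u = snd (fst f (\<zero>\<^bsub>M\<^esub>, u))"

definition block_UM :: "('m, 'u, 'w) open_sys \<Rightarrow> 'm \<Rightarrow> 'w" where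
  "block_UM f m = snd f m"

text \<open>The system whose blocks are \<open>a\<close>, \<open>b\<close>, \<open>c\<close> and zero.\<close>

definition from_blocks :: "(real, 'm) module \<Rightarrow> (real, 'u) module
    \<Rightarrow> ('m \<Rightarrow> 'm) \<Rightarrow> ('u \<Rightarrow> 'm) \<Rightarrow> ('m \<Rightarrow> 'w) \<Rightarrow> ('m, 'u, 'w) open_sys" where
  "from_blocks M U a b c =
     (\<lambda>(m, u) \<in> carrier M \<times> carrier U. (m, a m \<oplus>\<^bsub>M\<^esub> b u), \<lambda>m \<in> carrier M. c m)"


section \<open>The algebra of linear open systems\<close>

type_synonym 'a lsys = "'a label tfs \<times>
  ('a label \<Rightarrow> real vec, 'a label \<Rightarrow> real vec, 'a label \<Rightarrow> real vec) open_sys"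

definition L_Obj :: "'a box \<Rightarrow> 'a lsys set" where
  "L_Obj X = {(S, f). S \<in> TFS \<and>
     linear_open_system (dprod S) (dprod (inp X)) (dprod (outp X)) f}"

definition L_Hom :: "'a wd \<Rightarrow> 'a lsys \<Rightarrow> 'a lsys" where
  "L_Hom = (\<lambda>(X, Y, \<phi>) (S, f).
     let fSS = block_MM (dprod S) (dprod (inp X)) f;
         fSX = block_MU (dprod S) (dprod (inp X)) f;
         fXS = block_UM f
     in (S, from_blocks (dprod S) (dprod (inp Y))
          (\<lambda>m. fSX (wire_XX (X, Y, \<phi>) (fXS m)) \<oplus>\<^bsub>dprod S\<^esub> fSS m)
          (\<lambda>y. fSX (wire_XY (X, Y, \<phi>) y))
          (\<lambda>m. wire_YX (X, Y, \<phi>) (fXS m))))"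

text \<open>\<open>direct_sum A A' B B' h h'\<close> is the direct sum of \<open>h\<close> and \<open>h'\<close>, as a map from the dependent
  product of \<open>A \<uplus>\<^sub>T A'\<close> to that of \<open>B \<uplus>\<^sub>T B'\<close>.\<close>

definition direct_sum :: "'a label tfs \<Rightarrow> 'a label tfs \<Rightarrow> 'a label tfs \<Rightarrow> 'a label tfs
    \<Rightarrow> (('a label \<Rightarrow> real vec) \<Rightarrow> 'a label \<Rightarrow> real vec)
    \<Rightarrow> (('a label \<Rightarrow> real vec) \<Rightarrow> 'a label \<Rightarrow> real vec)
    \<Rightarrow> ('a label \<Rightarrow> real vec) \<Rightarrow> 'a label \<Rightarrow> real vec" where
  "direct_sum A A' B B' h h' x =
     (let y = h (\<lambda>a \<in> fst A. x (join (fst A) (Inl a)));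
          y' = h' (\<lambda>a \<in> fst A'. x (join (fst A) (Inr a)))
      in (\<lambda>c \<in> fst (B \<uplus>\<^sub>T B'). case_sum y y' (split (fst B) c)))"

definition L_mu :: "'a box \<Rightarrow> 'a box \<Rightarrow> 'a lsys \<times> 'a lsys \<Rightarrow> 'a lsys" where
  "L_mu X X' = (\<lambda>((S, f), (S', f')).
     (S \<uplus>\<^sub>T S', from_blocks (dprod (S \<uplus>\<^sub>T S')) (dprod (inp (X \<oplus>\<^sub>W X')))
       (direct_sum S S' S S'
          (block_MM (dprod S) (dprod (inp X)) f) (block_MM (dprod S') (dprod (inp X')) f'))
       (direct_sum (inp X) (inp X') S S'
          (block_MU (dprod S) (dprod (inp X)) f) (block_MU (dprod S') (dprod (inp X')) f'))
       (direct_sum S S' (outp X) (outp X') (block_UM f) (block_UM f'))))"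

text \<open>The trivial system on the box \<open>0\<close>: the state set is empty and all blocks are zero.\<close>

definition L_unit :: "'a lsys" where
  "L_unit = (TFS_empty, from_blocks (dprod TFS_empty) (dprod TFS_empty)
     (\<lambda>_. \<zero>\<^bsub>dprod TFS_empty\<^esub>) (\<lambda>_. \<zero>\<^bsub>dprod TFS_empty\<^esub>) (\<lambda>_. \<zero>\<^bsub>dprod TFS_empty\<^esub>))"

end

theory Submission
  imports Defs
begin

text \<open>The coproduct of labelled sets is strictly associative and unital, so all coherence
  conditions except those for the braiding reduce to equations between wirings, which are checked
  by following a single wire.  A system is determined by its three linear blocks, and the blocks of
  its image under a diagram are composites with the three blocks of the wiring.  Functoriality of
  \<open>L_Hom\<close> therefore comes down to the composition law for wiring blocks, in which a wire either
  stays outside the middle box or passes through it exactly once; naturality of \<open>L_mu\<close> comes down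
  to the fact that the blocks of a sum of wirings are direct sums.\<close>

section \<open>Coproducts of typed finite sets\<close>

text \<open>Strictness of the coproduct is forced, not a convenience. \<open>L_Hom\<close> never
  changes the state set of a system, so no structure isomorphism of boxes can repair a mismatch
  between \<open>(S + S') + S''\<close> and \<open>S + (S' + S'')\<close>: the axioms
  \<open>mu_assoc\<close>, \<open>mu_lunit\<close> and \<open>mu_runit\<close> can hold as equations
  only if state sets themselves add strictly. Shifting tags by \<open>height\<close> achieves this
  because heights add and the empty set has height \<open>0\<close>. A wiring is read backwards: it
  sends each port that receives a signal (an input of the inner box, an output of the outer one) to
  the port that supplies it. Outputs of the outer box are supplied only by outputs of the inner one,
  so tracing back through a composite never enters the middle box twice, and no feedback equation
  has to be solved. The cost of strictness is that simplification turns a shift past a compound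
  coproduct into nested shifts, after which rules about the right summand of the compound no longer
  match; their instances are then supplied by hand.\<close>

lemma height_le: "\<lbrakk>finite A; a \<in> A\<rbrakk> \<Longrightarrow> snd a < height A"
  using cSUP_upper[of a A "\<lambda>a. Suc (snd a)"] by (simp add: height_def bdd_above_nat)

text \<open>The supremum of the empty set of naturals is \<open>0\<close>; this default makes the
  shift past an empty set trivial and hence the coproduct strictly unital.\<close>

lemma height_empty [simp]: "height {} = 0"
  by (simp add: height_def)

lemma join_Inl [simp]: "join A (Inl a) = a"
  by (simp add: join_def)

text \<open>A shifted tag is at least \<open>height A\<close>, so the comparison in
  \<open>split\<close> always falls on the right side. For \<open>split_Inl\<close> below,
  finiteness makes \<open>height A\<close> exceed every tag of \<open>A\<close>.\<close>

lemma split_join_Inr [simp]: "split A (join A (Inr b)) = Inr b"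
  by (simp add: join_def split_def)

lemma split_Inl [simp]: "\<lbrakk>finite A; a \<in> A\<rbrakk> \<Longrightarrow> split A a = Inl a"
  by (simp add: split_def height_le)

lemma join_empty [simp]: "join {} (Inr b) = b"
  by (simp add: join_def)

lemma split_empty [simp]: "split {} b = Inr b"
  by (simp add: split_def)

lemma join_Inr_eq_iff [simp]: "join A (Inr b) = join A (Inr b') \<longleftrightarrow> b = b'"
  by (metis split_join_Inr sum.inject(2))

lemma TFS_finite: "A \<in> TFS \<Longrightarrow> finite (fst A)"
  by (auto simp: TFS_def)

lemma mem_TFS_union: "c \<in> fst (A \<uplus>\<^sub>T B) \<longleftrightarrow> c \<in> fst A \<or> (\<exists>b \<in> fst B. c = join (fst A) (Inr b))"
  by (simp add: TFS_union_def Let_def Plus_def image_Un image_image image_iff)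

text \<open>Both summands live in one label type; this rule takes the place of a case distinction on
  a sum type.\<close>

lemma TFS_union_cases [consumes 1, case_names left right]:
  assumes "c \<in> fst (A \<uplus>\<^sub>T B)"
  obtains "c \<in> fst A" | b where "b \<in> fst B" "c = join (fst A) (Inr b)"
  using assms by (auto simp: mem_TFS_union)

lemma TFS_union_leftI [simp]: "a \<in> fst A \<Longrightarrow> a \<in> fst (A \<uplus>\<^sub>T B)"
  by (simp add: mem_TFS_union)

lemma TFS_union_rightI [simp]: "b \<in> fst B \<Longrightarrow> join (fst A) (Inr b) \<in> fst (A \<uplus>\<^sub>T B)"
  by (auto simp: mem_TFS_union)

lemma type_TFS_union_left [simp]:
  "\<lbrakk>A \<in> TFS; a \<in> fst A\<rbrakk> \<Longrightarrow> snd (A \<uplus>\<^sub>T B) a = snd A a"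
  using TFS_union_leftI[of a A B] by (simp add: TFS_union_def Let_def TFS_finite)

lemma type_TFS_union_right [simp]:
  "b \<in> fst B \<Longrightarrow> snd (A \<uplus>\<^sub>T B) (join (fst A) (Inr b)) = snd B b"
  using TFS_union_rightI[of b B A] by (simp add: TFS_union_def Let_def)

lemma TFS_union_in [simp]: "\<lbrakk>A \<in> TFS; B \<in> TFS\<rbrakk> \<Longrightarrow> A \<uplus>\<^sub>T B \<in> TFS"
  by (auto simp: TFS_union_def TFS_def Let_def)

lemma TFS_empty_in [simp]: "TFS_empty \<in> TFS"
  by (auto simp: TFS_empty_def TFS_def)

lemma fst_TFS_empty [simp]: "fst TFS_empty = {}"
  by (simp add: TFS_empty_def)

lemma TFS_eqI:
  assumes "A \<in> TFS" "B \<in> TFS" "fst A = fst B" "\<And>a. a \<in> fst A \<Longrightarrow> snd A a = snd B a"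
  shows "A = B"
  using assms by (auto simp: TFS_def prod_eq_iff intro!: extensionalityI[of _ "fst A"])

text \<open>The largest tag of a nonempty second summand, once shifted, lies above all tags of the
  first; an empty second summand changes neither side. This additivity is the source of strict
  associativity.\<close>

lemma height_TFS_union:
  assumes "A \<in> TFS" "B \<in> TFS"
  shows "height (fst (A \<uplus>\<^sub>T B)) = height (fst A) + height (fst B)"
proof -
  have un: "fst (A \<uplus>\<^sub>T B) = fst A \<union> (\<lambda>b. join (fst A) (Inr b)) ` fst B"
    by (auto simp: mem_TFS_union)
  show ?thesis
  proof (cases "fst B = {}")
    case True
    then show ?thesis by (simp add: un)
  next
    case False
    have fin: "finite (fst A)" "finite (fst B)"
      using assms by (auto simp: TFS_finite)
    have "height (fst (A \<uplus>\<^sub>T B)) \<le> height (fst A) + height (fst B)"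
      unfolding height_def[of "fst (A \<uplus>\<^sub>T B)"]
    proof (rule cSUP_least)
      show "fst (A \<uplus>\<^sub>T B) \<noteq> {}" using False by (auto simp: un)
      fix c assume "c \<in> fst (A \<uplus>\<^sub>T B)"
      then show "Suc (snd c) \<le> height (fst A) + height (fst B)"
        using height_le[OF fin(1)] height_le[OF fin(2)]
        by (cases rule: TFS_union_cases) (fastforce simp: join_def Suc_le_eq)+
    qed
    moreover have "height (fst B) \<le> height (fst (A \<uplus>\<^sub>T B)) - height (fst A)"
      unfolding height_def[of "fst B"]
    proof (rule cSUP_least[OF False])
      fix b assume "b \<in> fst B"
      then have "join (fst A) (Inr b) \<in> fst (A \<uplus>\<^sub>T B)" by simp
      from height_le[OF _ this] show "Suc (snd b) \<le> height (fst (A \<uplus>\<^sub>T B)) - height (fst A)"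
        by (simp add: join_def TFS_finite assms)
    qed
    \<comment> \<open>The bound just proved uses truncated subtraction; positivity of the left side
      shows that nothing was truncated, so it becomes a bound on the sum.\<close>
    moreover have "height (fst B) > 0"
      using False height_le[OF fin(2)] by fastforce
    ultimately show ?thesis by simp
  qed
qed

text \<open>Both sides shift by the sum of the two heights. As a simp rule it makes nested shifts
  the normal form.\<close>

lemma join_TFS_union [simp]:
  assumes "A \<in> TFS" "B \<in> TFS"
  shows "join (fst (A \<uplus>\<^sub>T B)) (Inr c) = join (fst A) (Inr (join (fst B) (Inr c)))"
  using assms by (simp add: join_def height_TFS_union)

lemma TFS_union_assoc:
  assumes "A \<in> TFS" "B \<in> TFS" "C \<in> TFS"
  shows "(A \<uplus>\<^sub>T B) \<uplus>\<^sub>T C = A \<uplus>\<^sub>T (B \<uplus>\<^sub>T C)"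
proof (rule TFS_eqI)
  show "fst ((A \<uplus>\<^sub>T B) \<uplus>\<^sub>T C) = fst (A \<uplus>\<^sub>T (B \<uplus>\<^sub>T C))"
    using assms by (auto simp: mem_TFS_union)
next
  fix c assume "c \<in> fst ((A \<uplus>\<^sub>T B) \<uplus>\<^sub>T C)"
  then show "snd ((A \<uplus>\<^sub>T B) \<uplus>\<^sub>T C) c = snd (A \<uplus>\<^sub>T (B \<uplus>\<^sub>T C)) c"
  proof (cases rule: TFS_union_cases)
    case left
    then show ?thesis using assms
      by (cases rule: TFS_union_cases) simp_all
  next
    case (right d)
    \<comment> \<open>With \<open>join_TFS_union\<close> active, the label would be rewritten before
      \<open>type_TFS_union_right\<close> could match it.\<close>
    then have "snd ((A \<uplus>\<^sub>T B) \<uplus>\<^sub>T C) c = snd C d"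
      by (simp del: join_TFS_union)
    then show ?thesis
      using right assms by simp
  qed
qed (use assms in auto)

lemma TFS_union_empty_left [simp]: "A \<in> TFS \<Longrightarrow> TFS_empty \<uplus>\<^sub>T A = A"
  by (rule TFS_eqI) (auto simp: mem_TFS_union, metis fst_TFS_empty join_empty type_TFS_union_right)

lemma TFS_union_empty_right [simp]: "A \<in> TFS \<Longrightarrow> A \<uplus>\<^sub>T TFS_empty = A"
  by (rule TFS_eqI) (auto simp: mem_TFS_union)

section \<open>Sum types and type-preserving bijections\<close>

lemma Inl_in_Plus_iff [simp]: "Inl a \<in> A <+> B \<longleftrightarrow> a \<in> A"
  and Inr_in_Plus_iff [simp]: "Inr b \<in> A <+> B \<longleftrightarrow> b \<in> B"
  by auto

lemma fst_TFS_plus [simp]: "fst (A +\<^sub>T B) = fst A <+> fst B"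
  by (simp add: TFS_plus_def)

lemma type_TFS_plus [simp]: "snd (A +\<^sub>T B) (Inl a) = snd A a" "snd (A +\<^sub>T B) (Inr b) = snd B b"
  by (simp_all add: TFS_plus_def)

text \<open>Extensionality, which \<open>TFS_hom\<close> demands, is dropped, so that unrestricted
  maps such as \<open>join\<close>, \<open>split\<close> and \<open>sum_middle\<close> qualify and
  can be composed.\<close>

definition typed_bij :: "'i tfs \<Rightarrow> 'j tfs \<Rightarrow> ('i \<Rightarrow> 'j) \<Rightarrow> bool" where
  "typed_bij A B q \<longleftrightarrow> bij_betw q (fst A) (fst B) \<and> (\<forall>a \<in> fst A. snd B (q a) = snd A a)"

lemma typed_bijI:
  assumes "\<And>a. a \<in> fst A \<Longrightarrow> q a \<in> fst B \<and> snd B (q a) = snd A a \<and> r (q a) = a"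
    and "\<And>b. b \<in> fst B \<Longrightarrow> r b \<in> fst A \<and> q (r b) = b"
  shows "typed_bij A B q"
  using assms unfolding typed_bij_def by (auto intro!: bij_betw_byWitness[where f' = r])

lemma typed_bij_comp: "\<lbrakk>typed_bij A B q; typed_bij B C r\<rbrakk> \<Longrightarrow> typed_bij A C (r \<circ> q)"
  unfolding typed_bij_def by (auto intro: bij_betw_trans dest: bij_betwE)

lemma typed_bij_map_sum:
  "\<lbrakk>typed_bij A A' q; typed_bij B B' r\<rbrakk> \<Longrightarrow> typed_bij (A +\<^sub>T B) (A' +\<^sub>T B') (map_sum q r)"
  by (rule typed_bijI[where r = "map_sum (inv_into (fst A) q) (inv_into (fst B) r)"])
    (auto simp: typed_bij_def bij_betw_def inv_into_into f_inv_into_f)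

text \<open>Exchanging the middle summands is its own inverse, at another type instance.\<close>

lemma typed_bij_sum_middle:
  "typed_bij ((A +\<^sub>T B) +\<^sub>T (C +\<^sub>T D)) ((A +\<^sub>T C) +\<^sub>T (B +\<^sub>T D)) sum_middle"
  by (rule typed_bijI[where r = sum_middle]) (auto simp: sum_middle_def)

lemma typed_bij_join: "A \<in> TFS \<Longrightarrow> typed_bij (A +\<^sub>T B) (A \<uplus>\<^sub>T B) (join (fst A))"
  by (rule typed_bijI[where r = "split (fst A)"])
    (auto simp: TFS_finite elim: TFS_union_cases)

lemma typed_bij_split: "A \<in> TFS \<Longrightarrow> typed_bij (A \<uplus>\<^sub>T B) (A +\<^sub>T B) (split (fst A))"
  by (rule typed_bijI[where r = "join (fst A)"])
    (auto simp: TFS_finite elim: TFS_union_cases)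

section \<open>The category of wiring diagrams\<close>

text \<open>The conditions of \<open>W_Hom\<close> on the bare wiring. The last one rules out
  feedthrough: an output of \<open>Y\<close> is supplied by an output of \<open>X\<close>, never
  directly by an input of \<open>Y\<close>.\<close>

definition wiring :: "'a box \<Rightarrow> 'a box \<Rightarrow> 'a wiring \<Rightarrow> bool" where
  "wiring X Y \<phi> \<longleftrightarrow> typed_bij (inp X +\<^sub>T outp Y) (outp X +\<^sub>T inp Y) \<phi> \<and>
     \<phi> \<in> extensional (fst (inp X) <+> fst (outp Y)) \<and>
     (\<forall>b \<in> fst (outp Y). \<exists>c \<in> fst (outp X). \<phi> (Inr b) = Inl c)"

lemma W_Hom_iff: "\<Phi> \<in> W_Hom X Y \<longleftrightarrow> (\<exists>\<phi>. \<Phi> = (X, Y, \<phi>) \<and> wiring X Y \<phi>)"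
proof -
  have "(X, Y, \<phi>) \<in> W_Hom X Y \<longleftrightarrow> wiring X Y \<phi>" for \<phi>
    by (auto simp: W_Hom_def wiring_def typed_bij_def TFS_hom_def PiE_iff image_subset_iff image_iff
        dest: bij_betwE)
  then show ?thesis by (auto simp: W_Hom_def)
qed

lemma W_HomE:
  assumes "\<Phi> \<in> W_Hom X Y"
  obtains \<phi> where "\<Phi> = (X, Y, \<phi>)" "wiring X Y \<phi>"
  using assms by (auto simp: W_Hom_iff)

lemma wiring_extensional [simp]:
  "wiring X Y \<phi> \<Longrightarrow> \<phi> \<in> extensional (fst (inp X) <+> fst (outp Y))"
  by (simp add: wiring_def)

lemma wiring_in_cases:
  assumes "wiring X Y \<phi>" "a \<in> fst (inp X)"
  obtains (out) b where "\<phi> (Inl a) = Inl b" "b \<in> fst (outp X)" "snd (outp X) b = snd (inp X) a"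
  | (inp) c where "\<phi> (Inl a) = Inr c" "c \<in> fst (inp Y)" "snd (inp Y) c = snd (inp X) a"
proof -
  have "\<phi> (Inl a) \<in> fst (outp X) <+> fst (inp Y)"
    using assms by (auto simp: wiring_def typed_bij_def dest!: bij_betwE)
  moreover have "snd (outp X +\<^sub>T inp Y) (\<phi> (Inl a)) = snd (inp X +\<^sub>T outp Y) (Inl a)"
    using assms unfolding wiring_def typed_bij_def fst_TFS_plus by blast
  ultimately show thesis using that by auto
qed

lemma wiring_out_cases:
  assumes "wiring X Y \<phi>" "b \<in> fst (outp Y)"
  obtains c where "\<phi> (Inr b) = Inl c" "c \<in> fst (outp X)" "snd (outp X) c = snd (outp Y) b"
proof -
  from assms obtain c where c: "c \<in> fst (outp X)" "\<phi> (Inr b) = Inl c"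
    by (auto simp: wiring_def)
  have "snd (outp X +\<^sub>T inp Y) (\<phi> (Inr b)) = snd (inp X +\<^sub>T outp Y) (Inr b)"
    using assms unfolding wiring_def typed_bij_def fst_TFS_plus by blast
  with c that show thesis by auto
qed

lemma wiring_inj:
  assumes "wiring X Y \<phi>" "\<phi> z = \<phi> z'"
    "z \<in> fst (inp X) <+> fst (outp Y)" "z' \<in> fst (inp X) <+> fst (outp Y)"
  shows "z = z'"
  using assms by (auto simp: wiring_def typed_bij_def bij_betw_def inj_on_def)

lemma wiring_surj:
  assumes "wiring X Y \<phi>" "z \<in> fst (outp X) <+> fst (inp Y)"
  obtains a where "a \<in> fst (inp X)" "\<phi> (Inl a) = z"
  | b where "b \<in> fst (outp Y)" "\<phi> (Inr b) = z"
proof -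
  have "\<phi> ` (fst (inp X) <+> fst (outp Y)) = fst (outp X) <+> fst (inp Y)"
    using assms by (auto simp: wiring_def typed_bij_def bij_betw_def)
  with assms(2) have "z \<in> \<phi> ` (fst (inp X) <+> fst (outp Y))" by simp
  with that show thesis by blast
qed

lemma wiring_eqI:
  assumes "\<phi> \<in> extensional (fst (inp X) <+> fst (outp Y))"
    "\<psi> \<in> extensional (fst (inp X) <+> fst (outp Y))"
    and "\<And>a. a \<in> fst (inp X) \<Longrightarrow> \<phi> (Inl a) = \<psi> (Inl a)"
    and "\<And>b. b \<in> fst (outp Y) \<Longrightarrow> \<phi> (Inr b) = \<psi> (Inr b)"
  shows "\<phi> = \<psi>"
  using assms by (auto intro: extensionalityI)

section \<open>Identities and composites of wirings\<close>

definition wiring_id :: "'a box \<Rightarrow> 'a wiring" where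
  "wiring_id X = (\<lambda>z \<in> fst (inp X) <+> fst (outp X). case_sum Inr Inl z)"

lemma W_Id_eq: "W_Id X = (X, X, wiring_id X)"
  by (simp add: W_Id_def wiring_id_def)

lemma wiring_id_simps [simp]:
  "a \<in> fst (inp X) \<Longrightarrow> wiring_id X (Inl a) = Inr a"
  "b \<in> fst (outp X) \<Longrightarrow> wiring_id X (Inr b) = Inl b"
  by (auto simp: wiring_id_def)

lemma wiring_wiring_id [simp]: "wiring X X (wiring_id X)"
proof -
  have "typed_bij (inp X +\<^sub>T outp X) (outp X +\<^sub>T inp X) (wiring_id X)"
    by (rule typed_bijI[where r = "case_sum Inr Inl"]) auto
  then show ?thesis by (auto simp: wiring_def) (simp add: wiring_id_def)
qed

text \<open>Composition does not inspect the middle box, hence the \<open>undefined\<close> entries.\<close>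

definition wiring_comp :: "'a box \<Rightarrow> 'a box \<Rightarrow> 'a wiring \<Rightarrow> 'a wiring \<Rightarrow> 'a wiring" where
  "wiring_comp X Z \<psi> \<phi> = snd (snd (W_Comp (undefined, Z, \<psi>) (X, undefined, \<phi>)))"

lemma W_Comp_eq: "W_Comp (Y', Z, \<psi>) (X, Y, \<phi>) = (X, Z, wiring_comp X Z \<psi> \<phi>)"
  by (simp add: wiring_comp_def W_Comp_def)

lemma wiring_comp_extensional [simp]:
  "wiring_comp X Z \<psi> \<phi> \<in> extensional (fst (inp X) <+> fst (outp Z))"
  by (simp add: wiring_comp_def W_Comp_def)

text \<open>The possible routes of a signal. \<open>wire_out\<close> takes \<open>projl\<close>,
  which has a meaning only on \<open>Inl\<close> values, so the hops it makes are spelled out as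
  hypotheses.\<close>

lemma wiring_comp_simps:
  "a \<in> fst (inp X) \<Longrightarrow> \<phi> (Inl a) = Inl b \<Longrightarrow> wiring_comp X Z \<psi> \<phi> (Inl a) = Inl b"
  "\<lbrakk>a \<in> fst (inp X); \<phi> (Inl a) = Inr y; \<psi> (Inl y) = Inl y'; \<phi> (Inr y') = Inl b'\<rbrakk>
    \<Longrightarrow> wiring_comp X Z \<psi> \<phi> (Inl a) = Inl b'"
  "\<lbrakk>a \<in> fst (inp X); \<phi> (Inl a) = Inr y; \<psi> (Inl y) = Inr z\<rbrakk>
    \<Longrightarrow> wiring_comp X Z \<psi> \<phi> (Inl a) = Inr z"
  "\<lbrakk>c \<in> fst (outp Z); \<psi> (Inr c) = Inl y'; \<phi> (Inr y') = Inl b'\<rbrakk>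
    \<Longrightarrow> wiring_comp X Z \<psi> \<phi> (Inr c) = Inl b'"
  by (auto simp: wiring_comp_def W_Comp_def wire_in_def wire_out_def sum_assoc_def codiag_def)

text \<open>There are only three routes because an output of \<open>Y\<close> is always supplied by
  an output of \<open>X\<close>: a trace that enters \<open>Y\<close> and comes back out ends in
  \<open>X\<close>. The types along the route are recorded for later dimension arguments.\<close>

lemma wiring_comp_in_cases:
  assumes \<phi>: "wiring X Y \<phi>" and \<psi>: "wiring Y Z \<psi>" and a: "a \<in> fst (inp X)"
  obtains b where "\<phi> (Inl a) = Inl b" "b \<in> fst (outp X)" "snd (outp X) b = snd (inp X) a"
      "wiring_comp X Z \<psi> \<phi> (Inl a) = Inl b"
  | y y' b where "\<phi> (Inl a) = Inr y" "y \<in> fst (inp Y)" "snd (inp Y) y = snd (inp X) a"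
      "\<psi> (Inl y) = Inl y'" "y' \<in> fst (outp Y)" "snd (outp Y) y' = snd (inp X) a"
      "\<phi> (Inr y') = Inl b" "b \<in> fst (outp X)" "snd (outp X) b = snd (inp X) a"
      "wiring_comp X Z \<psi> \<phi> (Inl a) = Inl b"
  | y z where "\<phi> (Inl a) = Inr y" "y \<in> fst (inp Y)" "snd (inp Y) y = snd (inp X) a"
      "\<psi> (Inl y) = Inr z" "z \<in> fst (inp Z)" "snd (inp Z) z = snd (inp X) a"
      "wiring_comp X Z \<psi> \<phi> (Inl a) = Inr z"
  using \<phi> a
proof (cases rule: wiring_in_cases)
  case (out b)
  then show thesis using that(1) wiring_comp_simps(1) a by metis
next
  case inp: (inp y)
  from \<psi> inp(2) show thesis
  proof (cases rule: wiring_in_cases)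
    case (out y')
    from \<phi> out(2) obtain b where "\<phi> (Inr y') = Inl b" "b \<in> fst (outp X)"
      "snd (outp X) b = snd (outp Y) y'"
      by (rule wiring_out_cases)
    then show thesis using that(2)[OF inp out(1,2)] out(3) inp(3)
      wiring_comp_simps(2)[of a X \<phi> y \<psi> y' b Z] a inp(1) out(1) by simp
  next
    case (inp z)
    then show thesis using that(3)[OF \<open>\<phi> (Inl a) = Inr y\<close> \<open>y \<in> fst (inp Y)\<close>]
      \<open>\<phi> (Inl a) = Inr y\<close> \<open>snd (inp Y) y = snd (inp X) a\<close>
      wiring_comp_simps(3)[of a X \<phi> y \<psi> z Z] a by simp
  qed
qed

lemma wiring_comp_out_cases:
  assumes \<phi>: "wiring X Y \<phi>" and \<psi>: "wiring Y Z \<psi>" and c: "c \<in> fst (outp Z)"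
  obtains y b where "\<psi> (Inr c) = Inl y" "y \<in> fst (outp Y)" "snd (outp Y) y = snd (outp Z) c"
    "\<phi> (Inr y) = Inl b" "b \<in> fst (outp X)" "snd (outp X) b = snd (outp Z) c"
    "wiring_comp X Z \<psi> \<phi> (Inr c) = Inl b"
proof -
  from \<psi> c obtain y where y: "\<psi> (Inr c) = Inl y" "y \<in> fst (outp Y)"
    "snd (outp Y) y = snd (outp Z) c"
    by (rule wiring_out_cases)
  from \<phi> y(2) obtain b where "\<phi> (Inr y) = Inl b" "b \<in> fst (outp X)"
    "snd (outp X) b = snd (outp Y) y"
    by (rule wiring_out_cases)
  with y that c show thesis using wiring_comp_simps(4)[of c Z \<psi> y \<phi> b X] by simp
qed

text \<open>Surjectivity follows a supplying port forwards through the two bijections; injectivity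
  compares routes and uses injectivity of \<open>\<phi>\<close> and \<open>\<psi>\<close> hop by
  hop.\<close>

lemma wiring_wiring_comp [simp]:
  assumes \<phi>: "wiring X Y \<phi>" and \<psi>: "wiring Y Z \<psi>"
  shows "wiring X Z (wiring_comp X Z \<psi> \<phi>)"
proof -
  let ?\<omega> = "wiring_comp X Z \<psi> \<phi>"
  let ?D = "fst (inp X) <+> fst (outp Z)"
  have types: "?\<omega> z \<in> fst (outp X) <+> fst (inp Z) \<and>
      snd (outp X +\<^sub>T inp Z) (?\<omega> z) = snd (inp X +\<^sub>T outp Z) z" if "z \<in> ?D" for z
    using that
  proof (rule PlusE)
    fix a assume "a \<in> fst (inp X)" and z: "z = Inl a"
    from \<phi> \<psi> this(1) show ?thesis by (cases rule: wiring_comp_in_cases) (auto simp: z)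
  next
    fix c assume "c \<in> fst (outp Z)" and z: "z = Inr c"
    from \<phi> \<psi> this(1) show ?thesis by (cases rule: wiring_comp_out_cases) (auto simp: z)
  qed
  have "fst (outp X) <+> fst (inp Z) \<subseteq> ?\<omega> ` ?D"
  proof
    fix w assume "w \<in> fst (outp X) <+> fst (inp Z)"
    then show "w \<in> ?\<omega> ` ?D"
    proof (rule PlusE)
      fix b assume b: "b \<in> fst (outp X)" and w: "w = Inl b"
      then have "Inl b \<in> fst (outp X) <+> fst (inp Y)" by simp
      with \<phi> show ?thesis
      proof (cases rule: wiring_surj)
        case (1 a)
        then have "?\<omega> (Inl a) = w" by (simp add: w wiring_comp_simps)
        with 1 show ?thesis by (metis imageI InlI)
      next
        \<comment> \<open>Here \<open>b\<close> supplies the output \<open>y'\<close> of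
          \<open>Y\<close>, so the search continues with what \<open>y'\<close> supplies under
          \<open>\<psi>\<close>: an input of \<open>Y\<close> or an output of
          \<open>Z\<close>.\<close>
        case (2 y')
        then have "Inl y' \<in> fst (outp Y) <+> fst (inp Z)" by simp
        with \<psi> show ?thesis
        proof (cases rule: wiring_surj)
          case y: (1 y)
          then have "Inr y \<in> fst (outp X) <+> fst (inp Y)" by simp
          with \<phi> show ?thesis
          proof (cases rule: wiring_surj)
            case (1 a)
            then have "?\<omega> (Inl a) = w" using y 2 by (simp add: w wiring_comp_simps)
            with 1 show ?thesis by (metis imageI InlI)
          \<comment> \<open>The other alternative is impossible: no output of \<open>Y\<close> is
            supplied by an input of \<open>Y\<close>.\<close>
          qed (metis \<phi> sum.distinct(1) wiring_out_cases)
        next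
          case (2 c)
          then have "?\<omega> (Inr c) = w" using \<open>\<phi> (Inr y') = Inl b\<close> by (simp add: w wiring_comp_simps)
          with 2 show ?thesis by (metis imageI InrI)
        qed
      qed
    next
      fix z assume z: "z \<in> fst (inp Z)" and w: "w = Inr z"
      then have "Inr z \<in> fst (outp Y) <+> fst (inp Z)" by simp
      with \<psi> show ?thesis
      proof (cases rule: wiring_surj)
        case y: (1 y)
        then have "Inr y \<in> fst (outp X) <+> fst (inp Y)" by simp
        with \<phi> show ?thesis
        proof (cases rule: wiring_surj)
          case (1 a)
          then have "?\<omega> (Inl a) = w" using y by (simp add: w wiring_comp_simps)
          with 1 show ?thesis by (metis imageI InlI)
        qed (metis \<phi> sum.distinct(1) wiring_out_cases)
      qed (metis \<psi> sum.distinct(1) wiring_out_cases)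
    qed
  qed
  moreover have "inj_on ?\<omega> ?D"
  proof (rule inj_onI)
    fix z z' assume "z \<in> ?D" "z' \<in> ?D" "?\<omega> z = ?\<omega> z'"
    then show "z = z'"
      \<comment> \<open>One goal for each pair of routes; equal ends are traced back to equal
        starts.\<close>
      by (elim PlusE; elim wiring_comp_in_cases[OF \<phi> \<psi>] wiring_comp_out_cases[OF \<phi> \<psi>])
        (metis wiring_inj[OF \<phi>] wiring_inj[OF \<psi>] Inl_in_Plus_iff Inr_in_Plus_iff sum.inject sum.distinct(1))+
  qed
  ultimately have "typed_bij (inp X +\<^sub>T outp Z) (outp X +\<^sub>T inp Z) ?\<omega>"
    using types by (auto simp: typed_bij_def bij_betw_def)
  moreover have "\<exists>b \<in> fst (outp X). ?\<omega> (Inr c) = Inl b" if "c \<in> fst (outp Z)" for c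
    using \<phi> \<psi> that by (cases rule: wiring_comp_out_cases) auto
  ultimately show ?thesis by (simp add: wiring_def)
qed

lemma wiring_comp_id_right:
  assumes "wiring X Y \<phi>"
  shows "wiring_comp X Y \<phi> (wiring_id X) = \<phi>"
proof (rule wiring_eqI[of _ X Y])
  fix a assume a: "a \<in> fst (inp X)"
  with assms show "wiring_comp X Y \<phi> (wiring_id X) (Inl a) = \<phi> (Inl a)"
    by (cases rule: wiring_in_cases) (simp_all add: wiring_comp_simps a)
next
  fix b assume b: "b \<in> fst (outp Y)"
  with assms show "wiring_comp X Y \<phi> (wiring_id X) (Inr b) = \<phi> (Inr b)"
    by (cases rule: wiring_out_cases) (simp_all add: wiring_comp_simps b)
qed (use assms in auto)

lemma wiring_comp_id_left:
  assumes "wiring X Y \<phi>"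
  shows "wiring_comp X Y (wiring_id Y) \<phi> = \<phi>"
proof (rule wiring_eqI[of _ X Y])
  fix a assume a: "a \<in> fst (inp X)"
  with assms show "wiring_comp X Y (wiring_id Y) \<phi> (Inl a) = \<phi> (Inl a)"
    by (cases rule: wiring_in_cases) (simp_all add: wiring_comp_simps a)
next
  fix b assume b: "b \<in> fst (outp Y)"
  with assms show "wiring_comp X Y (wiring_id Y) \<phi> (Inr b) = \<phi> (Inr b)"
    by (cases rule: wiring_out_cases) (simp_all add: wiring_comp_simps b)
qed (use assms in auto)

lemma wiring_comp_assoc:
  assumes \<phi>: "wiring X Y \<phi>" and \<psi>: "wiring Y Z \<psi>" and \<chi>: "wiring Z V \<chi>"
  shows "wiring_comp X V (wiring_comp Y V \<chi> \<psi>) \<phi> = wiring_comp X V \<chi> (wiring_comp X Z \<psi> \<phi>)"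
proof (rule wiring_eqI[of _ X V])
  fix a assume a: "a \<in> fst (inp X)"
  from \<phi> \<psi> this show "wiring_comp X V (wiring_comp Y V \<chi> \<psi>) \<phi> (Inl a)
      = wiring_comp X V \<chi> (wiring_comp X Z \<psi> \<phi>) (Inl a)"
  proof (cases rule: wiring_comp_in_cases)
    \<comment> \<open>Only the route that reaches an input of \<open>Z\<close> consults
      \<open>\<chi>\<close>; the other two end at an output of \<open>X\<close>.\<close>
    case (3 y z)
    from \<chi> \<open>z \<in> fst (inp Z)\<close> show ?thesis
    proof (cases rule: wiring_in_cases)
      case (out z')
      from \<phi> \<psi> out(2) show ?thesis
        by (cases rule: wiring_comp_out_cases) (simp add: wiring_comp_simps a 3 out)
    next
      case (inp v)
      then show ?thesis by (simp add: wiring_comp_simps a 3)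
    qed
  qed (simp_all add: wiring_comp_simps a)
next
  fix d assume d: "d \<in> fst (outp V)"
  with \<chi> obtain z where z: "\<chi> (Inr d) = Inl z" "z \<in> fst (outp Z)" by (rule wiring_out_cases)
  from \<phi> \<psi> z(2) show "wiring_comp X V (wiring_comp Y V \<chi> \<psi>) \<phi> (Inr d)
      = wiring_comp X V \<chi> (wiring_comp X Z \<psi> \<phi>) (Inr d)"
    by (cases rule: wiring_comp_out_cases) (simp add: wiring_comp_simps d z)
qed simp_all

text \<open>A diagram records its source and target boxes, which makes the hom-sets
  disjoint.\<close>

lemma W_small_category: "small_category W_Obj W_Hom W_Id W_Comp"
  by unfold_locales
    (auto simp: W_Hom_iff W_Id_eq W_Comp_eq wiring_comp_id_right wiring_comp_id_left
      wiring_comp_assoc)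

interpretation W: small_category W_Obj W_Hom W_Id W_Comp
  by (rule W_small_category)

text \<open>Associators and unitors are identity diagrams, so this gives their
  invertibility.\<close>

lemma W_iso_arrow_Id: "X \<in> W_Obj \<Longrightarrow> W.iso_arrow X X (W_Id X)"
  unfolding W.iso_arrow_def by (metis W.Id_in W.Id_left)

section \<open>The monoidal structure\<close>

lemma inp_TFS [simp]: "X \<in> W_Obj \<Longrightarrow> inp X \<in> TFS"
  and outp_TFS [simp]: "X \<in> W_Obj \<Longrightarrow> outp X \<in> TFS"
  by (auto simp: W_Obj_def)

lemma finite_inp [simp]: "X \<in> W_Obj \<Longrightarrow> finite (fst (inp X))"
  and finite_outp [simp]: "X \<in> W_Obj \<Longrightarrow> finite (fst (outp X))"
  by (simp_all add: TFS_finite)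

lemma inp_W_sum [simp]: "inp (X \<oplus>\<^sub>W Y) = inp X \<uplus>\<^sub>T inp Y"
  and outp_W_sum [simp]: "outp (X \<oplus>\<^sub>W Y) = outp X \<uplus>\<^sub>T outp Y"
  by (simp_all add: W_sum_def)

lemma W_sum_in [simp]: "\<lbrakk>X \<in> W_Obj; Y \<in> W_Obj\<rbrakk> \<Longrightarrow> X \<oplus>\<^sub>W Y \<in> W_Obj"
  by (auto simp: W_Obj_def W_sum_def)

lemma W_zero_in [simp]: "W_zero \<in> W_Obj"
  by (simp add: W_Obj_def W_zero_def)

lemma inp_W_zero [simp]: "inp W_zero = TFS_empty"
  and outp_W_zero [simp]: "outp W_zero = TFS_empty"
  by (simp_all add: W_zero_def)

lemma W_sum_assoc: "\<lbrakk>X \<in> W_Obj; Y \<in> W_Obj; Z \<in> W_Obj\<rbrakk> \<Longrightarrow> (X \<oplus>\<^sub>W Y) \<oplus>\<^sub>W Z = X \<oplus>\<^sub>W (Y \<oplus>\<^sub>W Z)"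
  by (simp add: W_sum_def TFS_union_assoc)

lemma W_sum_zero [simp]: "X \<in> W_Obj \<Longrightarrow> W_zero \<oplus>\<^sub>W X = X" "X \<in> W_Obj \<Longrightarrow> X \<oplus>\<^sub>W W_zero = X"
  by (simp_all add: prod_eq_iff)

definition wiring_sum :: "'a box \<Rightarrow> 'a box \<Rightarrow> 'a box \<Rightarrow> 'a box \<Rightarrow> 'a wiring \<Rightarrow> 'a wiring \<Rightarrow> 'a wiring" where
  "wiring_sum X1 Y1 X2 Y2 \<phi>1 \<phi>2 = snd (snd (W_sum_hom (X1, Y1, \<phi>1) (X2, Y2, \<phi>2)))"

lemma W_sum_hom_eq:
  "W_sum_hom (X1, Y1, \<phi>1) (X2, Y2, \<phi>2) = (X1 \<oplus>\<^sub>W X2, Y1 \<oplus>\<^sub>W Y2, wiring_sum X1 Y1 X2 Y2 \<phi>1 \<phi>2)"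
  by (simp add: wiring_sum_def W_sum_hom_def)

lemma wiring_sum_extensional [simp]:
  "wiring_sum X1 Y1 X2 Y2 \<phi>1 \<phi>2 \<in> extensional (fst (inp X1 \<uplus>\<^sub>T inp X2) <+> fst (outp Y1 \<uplus>\<^sub>T outp Y2))"
  by (simp add: wiring_sum_def W_sum_hom_def)

text \<open>Finiteness of the box is what lets \<open>split\<close> recognise a label of the left
  summand; labels of the right summand are recognised by their shifted tags.\<close>

lemma wiring_sum_in_left:
  assumes "X1 \<in> W_Obj" "a \<in> fst (inp X1)"
  shows "\<phi>1 (Inl a) = Inl b \<Longrightarrow> wiring_sum X1 Y1 X2 Y2 \<phi>1 \<phi>2 (Inl a) = Inl b"
    and "\<phi>1 (Inl a) = Inr c \<Longrightarrow> wiring_sum X1 Y1 X2 Y2 \<phi>1 \<phi>2 (Inl a) = Inr c"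
  using assms by (simp_all add: wiring_sum_def W_sum_hom_def sum_middle_def)

lemma wiring_sum_in_right:
  assumes "a \<in> fst (inp X2)"
  shows "\<phi>2 (Inl a) = Inl b \<Longrightarrow> wiring_sum X1 Y1 X2 Y2 \<phi>1 \<phi>2 (Inl (join (fst (inp X1)) (Inr a)))
      = Inl (join (fst (outp X1)) (Inr b))"
    and "\<phi>2 (Inl a) = Inr c \<Longrightarrow> wiring_sum X1 Y1 X2 Y2 \<phi>1 \<phi>2 (Inl (join (fst (inp X1)) (Inr a)))
      = Inr (join (fst (inp Y1)) (Inr c))"
  using assms by (simp_all add: wiring_sum_def W_sum_hom_def sum_middle_def)

lemma wiring_sum_out:
  "\<lbrakk>Y1 \<in> W_Obj; b \<in> fst (outp Y1); \<phi>1 (Inr b) = Inl c\<rbrakk>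
    \<Longrightarrow> wiring_sum X1 Y1 X2 Y2 \<phi>1 \<phi>2 (Inr b) = Inl c"
  "\<lbrakk>b \<in> fst (outp Y2); \<phi>2 (Inr b) = Inl c\<rbrakk>
    \<Longrightarrow> wiring_sum X1 Y1 X2 Y2 \<phi>1 \<phi>2 (Inr (join (fst (outp Y1)) (Inr b)))
      = Inl (join (fst (outp X1)) (Inr c))"
  by (simp_all add: wiring_sum_def W_sum_hom_def sum_middle_def)

lemmas wiring_sum_simps = wiring_sum_in_left wiring_sum_in_right wiring_sum_out

lemma typed_bij_cong:
  "(\<And>a. a \<in> fst A \<Longrightarrow> q a = r a) \<Longrightarrow> typed_bij A B q \<longleftrightarrow> typed_bij A B r"
  unfolding typed_bij_def by (metis bij_betw_cong)

text \<open>Before restriction the sum is a composite of five typed bijections; restricting to the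
  domain changes no value there.\<close>

lemma wiring_wiring_sum [simp]:
  assumes X1: "X1 \<in> W_Obj" and Y1: "Y1 \<in> W_Obj"
    and \<phi>1: "wiring X1 Y1 \<phi>1" and \<phi>2: "wiring X2 Y2 \<phi>2"
  shows "wiring (X1 \<oplus>\<^sub>W X2) (Y1 \<oplus>\<^sub>W Y2) (wiring_sum X1 Y1 X2 Y2 \<phi>1 \<phi>2)"
proof -
  have "typed_bij (inp (X1 \<oplus>\<^sub>W X2) +\<^sub>T outp (Y1 \<oplus>\<^sub>W Y2)) (outp (X1 \<oplus>\<^sub>W X2) +\<^sub>T inp (Y1 \<oplus>\<^sub>W Y2))
     (map_sum (join (fst (outp X1))) (join (fst (inp Y1))) \<circ> (sum_middle
          \<circ> (map_sum \<phi>1 \<phi>2 \<circ> (sum_middle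
          \<circ> map_sum (split (fst (inp X1))) (split (fst (outp Y1)))))))"
    unfolding inp_W_sum outp_W_sum
    by (rule typed_bij_comp typed_bij_map_sum typed_bij_join typed_bij_split typed_bij_sum_middle
          \<phi>1[unfolded wiring_def, THEN conjunct1] \<phi>2[unfolded wiring_def, THEN conjunct1]
          inp_TFS outp_TFS X1 Y1)+
  then have "typed_bij (inp (X1 \<oplus>\<^sub>W X2) +\<^sub>T outp (Y1 \<oplus>\<^sub>W Y2)) (outp (X1 \<oplus>\<^sub>W X2) +\<^sub>T inp (Y1 \<oplus>\<^sub>W Y2))
      (wiring_sum X1 Y1 X2 Y2 \<phi>1 \<phi>2)"
    by (rule iffD1[OF typed_bij_cong, rotated]) (simp add: wiring_sum_def W_sum_hom_def o_assoc)
  moreover have "\<exists>c \<in> fst (outp X1 \<uplus>\<^sub>T outp X2). wiring_sum X1 Y1 X2 Y2 \<phi>1 \<phi>2 (Inr b) = Inl c"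
    if "b \<in> fst (outp Y1 \<uplus>\<^sub>T outp Y2)" for b
    using that
  proof (cases rule: TFS_union_cases)
    case left
    with \<phi>1 obtain c where "\<phi>1 (Inr b) = Inl c" "c \<in> fst (outp X1)" by (rule wiring_out_cases)
    with left Y1 show ?thesis by (auto simp: wiring_sum_simps)
  next
    case (right b')
    with \<phi>2 obtain c where "\<phi>2 (Inr b') = Inl c" "c \<in> fst (outp X2)" by (elim wiring_out_cases)
    with right show ?thesis by (auto simp: wiring_sum_simps)
  qed
  ultimately show ?thesis by (simp add: wiring_def)
qed

lemma wiring_sum_eqI:
  assumes "\<phi> \<in> extensional (fst (inp X1 \<uplus>\<^sub>T inp X2) <+> fst (outp Y1 \<uplus>\<^sub>T outp Y2))"
    "\<psi> \<in> extensional (fst (inp X1 \<uplus>\<^sub>T inp X2) <+> fst (outp Y1 \<uplus>\<^sub>T outp Y2))"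
    and "\<And>a. a \<in> fst (inp X1) \<Longrightarrow> \<phi> (Inl a) = \<psi> (Inl a)"
    and "\<And>a. a \<in> fst (inp X2) \<Longrightarrow> \<phi> (Inl (join (fst (inp X1)) (Inr a))) = \<psi> (Inl (join (fst (inp X1)) (Inr a)))"
    and "\<And>b. b \<in> fst (outp Y1) \<Longrightarrow> \<phi> (Inr b) = \<psi> (Inr b)"
    and "\<And>b. b \<in> fst (outp Y2) \<Longrightarrow> \<phi> (Inr (join (fst (outp Y1)) (Inr b))) = \<psi> (Inr (join (fst (outp Y1)) (Inr b)))"
  shows "\<phi> = \<psi>"
proof (rule wiring_eqI[of _ "X1 \<oplus>\<^sub>W X2" "Y1 \<oplus>\<^sub>W Y2"])
  fix a assume "a \<in> fst (inp (X1 \<oplus>\<^sub>W X2))"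
  then have "a \<in> fst (inp X1 \<uplus>\<^sub>T inp X2)" by simp
  then show "\<phi> (Inl a) = \<psi> (Inl a)" by (cases rule: TFS_union_cases) (simp_all add: assms)
next
  fix b assume "b \<in> fst (outp (Y1 \<oplus>\<^sub>W Y2))"
  then have "b \<in> fst (outp Y1 \<uplus>\<^sub>T outp Y2)" by simp
  then show "\<phi> (Inr b) = \<psi> (Inr b)" by (cases rule: TFS_union_cases) (simp_all add: assms)
qed (use assms in auto)

lemma wiring_sum_id:
  assumes [simp]: "X1 \<in> W_Obj" "X2 \<in> W_Obj"
  shows "wiring_sum X1 X1 X2 X2 (wiring_id X1) (wiring_id X2) = wiring_id (X1 \<oplus>\<^sub>W X2)"
  using wiring_extensional[OF wiring_wiring_id, of "X1 \<oplus>\<^sub>W X2"]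
  by (intro wiring_sum_eqI[of _ X1 X2 X1 X2]) (simp_all add: wiring_sum_simps)

text \<open>No wire crosses between the summands, so tracing a wire through the sums repeats its
  route within one summand.\<close>

lemma wiring_sum_comp:
  assumes [simp]: "X1 \<in> W_Obj" "Y1 \<in> W_Obj" "Z1 \<in> W_Obj" "X2 \<in> W_Obj" "Y2 \<in> W_Obj" "Z2 \<in> W_Obj"
    and \<phi>1: "wiring X1 Y1 \<phi>1" and \<psi>1: "wiring Y1 Z1 \<psi>1"
    and \<phi>2: "wiring X2 Y2 \<phi>2" and \<psi>2: "wiring Y2 Z2 \<psi>2"
  shows "wiring_sum X1 Z1 X2 Z2 (wiring_comp X1 Z1 \<psi>1 \<phi>1) (wiring_comp X2 Z2 \<psi>2 \<phi>2)
    = wiring_comp (X1 \<oplus>\<^sub>W X2) (Z1 \<oplus>\<^sub>W Z2) (wiring_sum Y1 Z1 Y2 Z2 \<psi>1 \<psi>2) (wiring_sum X1 Y1 X2 Y2 \<phi>1 \<phi>2)"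
    (is "?L = ?R")
proof (rule wiring_sum_eqI[of _ X1 X2 Z1 Z2])
  fix a assume a: "a \<in> fst (inp X1)"
  from \<phi>1 \<psi>1 a show "?L (Inl a) = ?R (Inl a)"
    by (cases rule: wiring_comp_in_cases) (simp_all add: wiring_comp_simps wiring_sum_simps a)
next
  fix a assume a: "a \<in> fst (inp X2)"
  from \<phi>2 \<psi>2 a show "?L (Inl (join (fst (inp X1)) (Inr a))) = ?R (Inl (join (fst (inp X1)) (Inr a)))"
    by (cases rule: wiring_comp_in_cases) (simp_all add: wiring_comp_simps wiring_sum_simps a)
next
  fix b assume b: "b \<in> fst (outp Z1)"
  from \<phi>1 \<psi>1 b show "?L (Inr b) = ?R (Inr b)"
    by (cases rule: wiring_comp_out_cases) (simp add: wiring_comp_simps wiring_sum_simps b)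
next
  fix b assume b: "b \<in> fst (outp Z2)"
  from \<phi>2 \<psi>2 b show "?L (Inr (join (fst (outp Z1)) (Inr b))) = ?R (Inr (join (fst (outp Z1)) (Inr b)))"
    by (cases rule: wiring_comp_out_cases) (simp add: wiring_comp_simps wiring_sum_simps b)
next
  show "?R \<in> extensional (fst (inp X1 \<uplus>\<^sub>T inp X2) <+> fst (outp Z1 \<uplus>\<^sub>T outp Z2))"
    using wiring_comp_extensional[of "X1 \<oplus>\<^sub>W X2" "Z1 \<oplus>\<^sub>W Z2"] by simp
qed simp

lemma wiring_sum_assoc:
  assumes [simp]: "X1 \<in> W_Obj" "Y1 \<in> W_Obj" "X2 \<in> W_Obj" "Y2 \<in> W_Obj" "X3 \<in> W_Obj" "Y3 \<in> W_Obj"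
    and \<phi>1: "wiring X1 Y1 \<phi>1" and \<phi>2: "wiring X2 Y2 \<phi>2" and \<phi>3: "wiring X3 Y3 \<phi>3"
  shows "wiring_sum (X1 \<oplus>\<^sub>W X2) (Y1 \<oplus>\<^sub>W Y2) X3 Y3 (wiring_sum X1 Y1 X2 Y2 \<phi>1 \<phi>2) \<phi>3
    = wiring_sum X1 Y1 (X2 \<oplus>\<^sub>W X3) (Y2 \<oplus>\<^sub>W Y3) \<phi>1 (wiring_sum X2 Y2 X3 Y3 \<phi>2 \<phi>3)" (is "?L = ?R")
proof (rule wiring_sum_eqI[of _ X1 "X2 \<oplus>\<^sub>W X3" Y1 "Y2 \<oplus>\<^sub>W Y3"])
  fix a assume a: "a \<in> fst (inp X1)"
  from \<phi>1 a show "?L (Inl a) = ?R (Inl a)"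
    by (cases rule: wiring_in_cases) (simp_all add: wiring_sum_simps a)
next
  fix a assume "a \<in> fst (inp (X2 \<oplus>\<^sub>W X3))"
  then have "a \<in> fst (inp X2 \<uplus>\<^sub>T inp X3)" by simp
  then show "?L (Inl (join (fst (inp X1)) (Inr a))) = ?R (Inl (join (fst (inp X1)) (Inr a)))"
  proof (cases rule: TFS_union_cases)
    case left
    from \<phi>2 left show ?thesis
      by (cases rule: wiring_in_cases) (simp_all add: wiring_sum_simps left)
  next
    case (right c)
    \<comment> \<open>Stated for the compound box and simplified together with the goal, so that
      both reach the normal form with nested shifts.\<close>
    note R = wiring_sum_in_right[OF right(1), of \<phi>3 _ "X1 \<oplus>\<^sub>W X2" "Y1 \<oplus>\<^sub>W Y2" Y3 "wiring_sum X1 Y1 X2 Y2 \<phi>1 \<phi>2"]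
    from \<phi>3 right(1) show ?thesis
      by (cases rule: wiring_in_cases) (use right R in \<open>simp_all add: wiring_sum_simps\<close>)
  qed
next
  fix b assume b: "b \<in> fst (outp Y1)"
  from \<phi>1 b show "?L (Inr b) = ?R (Inr b)"
    by (cases rule: wiring_out_cases) (simp add: wiring_sum_simps b)
next
  fix b assume "b \<in> fst (outp (Y2 \<oplus>\<^sub>W Y3))"
  then have "b \<in> fst (outp Y2 \<uplus>\<^sub>T outp Y3)" by simp
  then show "?L (Inr (join (fst (outp Y1)) (Inr b))) = ?R (Inr (join (fst (outp Y1)) (Inr b)))"
  proof (cases rule: TFS_union_cases)
    case left
    from \<phi>2 left show ?thesis
      by (cases rule: wiring_out_cases) (simp add: wiring_sum_simps left)
  next
    case (right c)
    note R = wiring_sum_out(2)[OF right(1), of \<phi>3 _ "X1 \<oplus>\<^sub>W X2" "Y1 \<oplus>\<^sub>W Y2" X3 "wiring_sum X1 Y1 X2 Y2 \<phi>1 \<phi>2"]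
    from \<phi>3 right(1) show ?thesis
      by (cases rule: wiring_out_cases) (use right R in \<open>simp add: wiring_sum_simps\<close>)
  qed
next
  show "?L \<in> extensional (fst (inp X1 \<uplus>\<^sub>T inp (X2 \<oplus>\<^sub>W X3)) <+> fst (outp Y1 \<uplus>\<^sub>T outp (Y2 \<oplus>\<^sub>W Y3)))"
    using wiring_sum_extensional[of "X1 \<oplus>\<^sub>W X2" "Y1 \<oplus>\<^sub>W Y2" X3 Y3] by (simp add: TFS_union_assoc)
qed (rule wiring_sum_extensional)

lemma wiring_sum_zero_left:
  assumes "X \<in> W_Obj" "Y \<in> W_Obj" "wiring X Y \<phi>"
  shows "wiring_sum W_zero W_zero X Y (wiring_id W_zero) \<phi> = \<phi>"
proof (rule wiring_eqI[of _ X Y])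
  fix a assume a: "a \<in> fst (inp X)"
  from assms(3) this show "wiring_sum W_zero W_zero X Y (wiring_id W_zero) \<phi> (Inl a) = \<phi> (Inl a)"
    \<comment> \<open>With \<open>W_zero\<close> on the left the shift is zero, so this instance
      speaks about the unshifted labels of \<open>X\<close>.\<close>
    using wiring_sum_in_right[of a X \<phi> _ W_zero W_zero Y "wiring_id W_zero"]
    by (cases rule: wiring_in_cases) (simp_all add: a)
next
  fix b assume b: "b \<in> fst (outp Y)"
  from assms(3) this show "wiring_sum W_zero W_zero X Y (wiring_id W_zero) \<phi> (Inr b) = \<phi> (Inr b)"
    using wiring_sum_out(2)[of b Y \<phi> _ W_zero W_zero X "wiring_id W_zero"]
    by (cases rule: wiring_out_cases) (simp_all add: b)
qed (use assms wiring_sum_extensional[of W_zero W_zero X Y] in simp_all)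

lemma wiring_sum_zero_right:
  assumes [simp]: "X \<in> W_Obj" "Y \<in> W_Obj" and \<phi>: "wiring X Y \<phi>"
  shows "wiring_sum X Y W_zero W_zero \<phi> (wiring_id W_zero) = \<phi>"
proof (rule wiring_eqI[of _ X Y])
  fix a assume a: "a \<in> fst (inp X)"
  from \<phi> this show "wiring_sum X Y W_zero W_zero \<phi> (wiring_id W_zero) (Inl a) = \<phi> (Inl a)"
    by (cases rule: wiring_in_cases) (simp_all add: wiring_sum_simps a)
next
  fix b assume b: "b \<in> fst (outp Y)"
  from \<phi> this show "wiring_sum X Y W_zero W_zero \<phi> (wiring_id W_zero) (Inr b) = \<phi> (Inr b)"
    by (cases rule: wiring_out_cases) (simp_all add: wiring_sum_simps b)
qed (use \<phi> wiring_sum_extensional[of X Y W_zero W_zero] in simp_all)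

lemma W_monoidal_category:
  "monoidal_category W_Obj W_Hom W_Id W_Comp W_sum W_sum_hom W_zero W_assoc W_unitor W_unitor"
proof -
  have Id_sum: "W_sum_hom (W_Id X) (W_Id Y) = W_Id (X \<oplus>\<^sub>W Y)" if "X \<in> W_Obj" "Y \<in> W_Obj" for X Y :: "'a box"
    using that by (simp add: W_Id_eq W_sum_hom_eq wiring_sum_id)
  have sum_assoc: "W_sum_hom (W_sum_hom f g) h = W_sum_hom f (W_sum_hom g h)"
    if "X \<in> W_Obj" "Y \<in> W_Obj" "Z \<in> W_Obj" "X' \<in> W_Obj" "Y' \<in> W_Obj" "Z' \<in> W_Obj"
      "f \<in> W_Hom X X'" "g \<in> W_Hom Y Y'" "h \<in> W_Hom Z Z'" for X Y Z X' Y' Z' and f g h :: "'a wd"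
    using that by (auto elim!: W_HomE simp: W_sum_hom_eq wiring_sum_assoc W_sum_assoc)
  have sum_in: "W_sum_hom f g \<in> W_Hom (X \<oplus>\<^sub>W Y) (X' \<oplus>\<^sub>W Y')"
    if "X \<in> W_Obj" "Y \<in> W_Obj" "X' \<in> W_Obj" "Y' \<in> W_Obj"
      "f \<in> W_Hom X X'" "g \<in> W_Hom Y Y'" for X Y X' Y' and f g :: "'a wd"
    using that by (auto simp: W_Hom_iff W_sum_hom_eq)
  have zero_left: "W_sum_hom (W_Id W_zero) f = f" and zero_right: "W_sum_hom f (W_Id W_zero) = f"
    if "X \<in> W_Obj" "Y \<in> W_Obj" "f \<in> W_Hom X Y" for X Y and f :: "'a wd"
    using that by (auto elim!: W_HomE simp: W_Id_eq W_sum_hom_eq wiring_sum_zero_left wiring_sum_zero_right)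
  show ?thesis
  proof (unfold_locales, goal_cases)
    \<comment> \<open>Cases 5 and 7 are interchange and naturality of the associator. The category
      axioms come from the interpretation \<open>W\<close>, and pentagon and triangle become
      equations between identities.\<close>
    case (5 A B C A' B' C' f g f' g')
    then show ?case by (auto elim!: W_HomE simp: W_Comp_eq W_sum_hom_eq wiring_sum_comp)
  next
    case (7 A B C A' B' C' f g h)
    \<comment> \<open>Cancelling the identity associators requires the triple sum as an arrow
      between the right-bracketed boxes.\<close>
    then show ?case using W.Id_left[of "A \<oplus>\<^sub>W B \<oplus>\<^sub>W C" "A' \<oplus>\<^sub>W B' \<oplus>\<^sub>W C'"]
        W.Id_right[of "A \<oplus>\<^sub>W B \<oplus>\<^sub>W C" "A' \<oplus>\<^sub>W B' \<oplus>\<^sub>W C'"]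
        sum_in[OF _ _ _ _ _ sum_in, of A "B" C A' B' C' f g h]
      by (simp add: W_assoc_def sum_assoc)
  qed (simp_all add: Id_sum sum_in W_assoc_def W_unitor_def W_sum_assoc W_iso_arrow_Id
        zero_left zero_right W.Id_left W.Id_right W.Id_left[OF _ _ W.Id_in])
qed

section \<open>The symmetry\<close>

definition wiring_braid :: "'a box \<Rightarrow> 'a box \<Rightarrow> 'a wiring" where
  "wiring_braid X Y = snd (snd (W_braid X Y))"

lemma W_braid_eq: "W_braid X Y = (X \<oplus>\<^sub>W Y, Y \<oplus>\<^sub>W X, wiring_braid X Y)"
  by (simp add: W_braid_def wiring_braid_def)

lemma wiring_braid_extensional [simp]:
  "wiring_braid X Y \<in> extensional (fst (inp X \<uplus>\<^sub>T inp Y) <+> fst (outp Y \<uplus>\<^sub>T outp X))"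
  by (simp add: W_braid_def wiring_braid_def)

lemma label_swap_left [simp]:
  "\<lbrakk>A \<in> TFS; a \<in> fst A\<rbrakk> \<Longrightarrow> label_swap A B a = join (fst B) (Inr a)"
  by (simp add: label_swap_def TFS_finite)

lemma label_swap_right [simp]: "label_swap A B (join (fst A) (Inr b)) = b"
  by (simp add: label_swap_def)

lemma wiring_braid_simps:
  "\<lbrakk>X \<in> W_Obj; a \<in> fst (inp X)\<rbrakk> \<Longrightarrow> wiring_braid X Y (Inl a) = Inr (join (fst (inp Y)) (Inr a))"
  "b \<in> fst (inp Y) \<Longrightarrow> wiring_braid X Y (Inl (join (fst (inp X)) (Inr b))) = Inr b"
  "\<lbrakk>Y \<in> W_Obj; c \<in> fst (outp Y)\<rbrakk> \<Longrightarrow> wiring_braid X Y (Inr c) = Inl (join (fst (outp X)) (Inr c))"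
  "d \<in> fst (outp X) \<Longrightarrow> wiring_braid X Y (Inr (join (fst (outp Y)) (Inr d))) = Inl d"
  by (simp_all add: W_braid_def wiring_braid_def)

lemma typed_bij_label_swap:
  assumes "A \<in> TFS" "B \<in> TFS"
  shows "typed_bij (A \<uplus>\<^sub>T B) (B \<uplus>\<^sub>T A) (label_swap A B)"
  by (rule typed_bijI[where r = "label_swap B A"])
    (use assms in \<open>auto elim!: TFS_union_cases\<close>)

lemma typed_bij_case_sum_swap:
  assumes "typed_bij A A' q" "typed_bij B B' r"
  shows "typed_bij (A +\<^sub>T B) (B' +\<^sub>T A') (case_sum (Inr \<circ> q) (Inl \<circ> r))"
proof -
  have "typed_bij (A' +\<^sub>T B') (B' +\<^sub>T A') (case_sum Inr Inl)"
    by (rule typed_bijI[where r = "case_sum Inr Inl"]) auto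
  from typed_bij_comp[OF typed_bij_map_sum[OF assms] this]
  show ?thesis by (simp add: case_sum_o_map_sum)
qed

text \<open>On outputs a wiring runs from the target box back to the source box, so the output
  component swaps against the direction of the input component.\<close>

lemma wiring_wiring_braid [simp]:
  assumes [simp]: "X \<in> W_Obj" "Y \<in> W_Obj"
  shows "wiring (X \<oplus>\<^sub>W Y) (Y \<oplus>\<^sub>W X) (wiring_braid X Y)"
proof -
  have "typed_bij (inp (X \<oplus>\<^sub>W Y) +\<^sub>T outp (Y \<oplus>\<^sub>W X)) (outp (X \<oplus>\<^sub>W Y) +\<^sub>T inp (Y \<oplus>\<^sub>W X))
      (case_sum (Inr \<circ> label_swap (inp X) (inp Y)) (Inl \<circ> label_swap (outp Y) (outp X)))"
    unfolding inp_W_sum outp_W_sum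
    by (intro typed_bij_case_sum_swap typed_bij_label_swap) simp_all
  then have "typed_bij (inp (X \<oplus>\<^sub>W Y) +\<^sub>T outp (Y \<oplus>\<^sub>W X)) (outp (X \<oplus>\<^sub>W Y) +\<^sub>T inp (Y \<oplus>\<^sub>W X))
      (wiring_braid X Y)"
    by (rule iffD1[OF typed_bij_cong, rotated]) (simp add: wiring_braid_def W_braid_def)
  moreover have "\<exists>c \<in> fst (outp X \<uplus>\<^sub>T outp Y). wiring_braid X Y (Inr b) = Inl c"
    if "b \<in> fst (outp Y \<uplus>\<^sub>T outp X)" for b
    using that by (cases rule: TFS_union_cases) (simp_all add: wiring_braid_simps)
  ultimately show ?thesis by (simp add: wiring_def)
qed

lemma wiring_braid_inv:
  assumes [simp]: "X \<in> W_Obj" "Y \<in> W_Obj"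
  shows "wiring_comp (X \<oplus>\<^sub>W Y) (X \<oplus>\<^sub>W Y) (wiring_braid Y X) (wiring_braid X Y) = wiring_id (X \<oplus>\<^sub>W Y)"
    (is "?L = ?R")
proof (rule wiring_sum_eqI[of _ X Y X Y])
  show "?L \<in> extensional (fst (inp X \<uplus>\<^sub>T inp Y) <+> fst (outp X \<uplus>\<^sub>T outp Y))"
    using wiring_comp_extensional[of "X \<oplus>\<^sub>W Y" "X \<oplus>\<^sub>W Y"] by simp
  show "?R \<in> extensional (fst (inp X \<uplus>\<^sub>T inp Y) <+> fst (outp X \<uplus>\<^sub>T outp Y))"
    using wiring_extensional[OF wiring_wiring_id, of "X \<oplus>\<^sub>W Y"] by simp
qed (simp_all add: wiring_comp_simps wiring_braid_simps)

lemma wiring_braid_nat: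
  assumes [simp]: "X \<in> W_Obj" "Y \<in> W_Obj" "X' \<in> W_Obj" "Y' \<in> W_Obj"
    and \<phi>: "wiring X X' \<phi>" and \<psi>: "wiring Y Y' \<psi>"
  shows "wiring_comp (X \<oplus>\<^sub>W Y) (Y' \<oplus>\<^sub>W X') (wiring_braid X' Y') (wiring_sum X X' Y Y' \<phi> \<psi>)
    = wiring_comp (X \<oplus>\<^sub>W Y) (Y' \<oplus>\<^sub>W X') (wiring_sum Y Y' X X' \<psi> \<phi>) (wiring_braid X Y)"
    (is "?L = ?R")
proof (rule wiring_sum_eqI[of _ X Y Y' X'])
  fix a assume a: "a \<in> fst (inp X)"
  from \<phi> a show "?L (Inl a) = ?R (Inl a)"
    by (cases rule: wiring_in_cases)
      (simp_all add: wiring_comp_simps wiring_sum_simps wiring_braid_simps a)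
next
  fix a assume a: "a \<in> fst (inp Y)"
  from \<psi> a show "?L (Inl (join (fst (inp X)) (Inr a))) = ?R (Inl (join (fst (inp X)) (Inr a)))"
    by (cases rule: wiring_in_cases)
      (simp_all add: wiring_comp_simps wiring_sum_simps wiring_braid_simps a)
next
  fix b assume b: "b \<in> fst (outp Y')"
  from \<psi> b show "?L (Inr b) = ?R (Inr b)"
    by (cases rule: wiring_out_cases)
      (simp add: wiring_comp_simps wiring_sum_simps wiring_braid_simps b)
next
  fix b assume b: "b \<in> fst (outp X')"
  from \<phi> b show "?L (Inr (join (fst (outp Y')) (Inr b))) = ?R (Inr (join (fst (outp Y')) (Inr b)))"
    by (cases rule: wiring_out_cases)
      (simp add: wiring_comp_simps wiring_sum_simps wiring_braid_simps b)
qed (use wiring_comp_extensional[of "X \<oplus>\<^sub>W Y" "Y' \<oplus>\<^sub>W X'"] in simp_all)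

text \<open>What remains of the hexagon once its identity associators are removed. It is checked on
  six kinds of labels, three of inputs and three of outputs.\<close>

lemma wiring_braid_hexagon:
  assumes [simp]: "X \<in> W_Obj" "Y \<in> W_Obj" "Z \<in> W_Obj"
  shows "wiring_braid X (Y \<oplus>\<^sub>W Z)
    = wiring_comp (X \<oplus>\<^sub>W Y \<oplus>\<^sub>W Z) (Y \<oplus>\<^sub>W Z \<oplus>\<^sub>W X)
        (wiring_sum Y Y (X \<oplus>\<^sub>W Z) (Z \<oplus>\<^sub>W X) (wiring_id Y) (wiring_braid X Z))
        (wiring_sum (X \<oplus>\<^sub>W Y) (Y \<oplus>\<^sub>W X) Z Z (wiring_braid X Y) (wiring_id Z))"
    (is "?L = wiring_comp _ _ ?\<psi> ?\<phi>")
proof (rule wiring_eqI[of _ "X \<oplus>\<^sub>W Y \<oplus>\<^sub>W Z" "Y \<oplus>\<^sub>W Z \<oplus>\<^sub>W X"])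
  fix a assume "a \<in> fst (inp (X \<oplus>\<^sub>W Y \<oplus>\<^sub>W Z))"
  then have "a \<in> fst (inp X \<uplus>\<^sub>T inp Y \<uplus>\<^sub>T inp Z)" by simp
  then show "?L (Inl a) = wiring_comp (X \<oplus>\<^sub>W Y \<oplus>\<^sub>W Z) (Y \<oplus>\<^sub>W Z \<oplus>\<^sub>W X) ?\<psi> ?\<phi> (Inl a)"
  proof (cases rule: TFS_union_cases)
    case left
    then show ?thesis by (simp add: wiring_comp_simps wiring_sum_simps wiring_braid_simps)
  next
    case (right d)
    from right(1) show ?thesis
    proof (cases rule: TFS_union_cases)
      case left
      with right show ?thesis by (simp add: wiring_comp_simps wiring_sum_simps wiring_braid_simps)
    next
      case z: (right z)
      \<comment> \<open>The rule for the right summand is instantiated with the compound box by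
        hand, because the shift past that box is normalised to nested shifts.\<close>
      then have "?\<phi> (Inl a) = Inr (join (fst (inp Y)) (Inr (join (fst (inp X)) (Inr z))))"
        using right wiring_sum_in_right(2)[of z Z "wiring_id Z" z "X \<oplus>\<^sub>W Y" "Y \<oplus>\<^sub>W X" Z "wiring_braid X Y"]
        by simp
      with z right show ?thesis by (simp add: wiring_comp_simps wiring_sum_simps wiring_braid_simps)
    qed
  qed
next
  fix b assume "b \<in> fst (outp (Y \<oplus>\<^sub>W Z \<oplus>\<^sub>W X))"
  then have "b \<in> fst (outp Y \<uplus>\<^sub>T outp Z \<uplus>\<^sub>T outp X)" by simp
  then show "?L (Inr b) = wiring_comp (X \<oplus>\<^sub>W Y \<oplus>\<^sub>W Z) (Y \<oplus>\<^sub>W Z \<oplus>\<^sub>W X) ?\<psi> ?\<phi> (Inr b)"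
  proof (cases rule: TFS_union_cases)
    case left
    then show ?thesis by (simp add: wiring_comp_simps wiring_sum_simps wiring_braid_simps)
  next
    case (right d)
    from right(1) show ?thesis
    proof (cases rule: TFS_union_cases)
      case left
      have "?\<phi> (Inr (join (fst (outp Y)) (Inr (join (fst (outp X)) (Inr d)))))
          = Inl (join (fst (outp X)) (Inr (join (fst (outp Y)) (Inr d))))"
        using left wiring_sum_out(2)[of d Z "wiring_id Z" d "X \<oplus>\<^sub>W Y" "Y \<oplus>\<^sub>W X" Z "wiring_braid X Y"]
        by simp
      with left right show ?thesis by (simp add: wiring_comp_simps wiring_sum_simps wiring_braid_simps)
    next
      case x: (right x)
      then have "?L (Inr b) = Inl x"
        using right wiring_braid_simps(4)[of x X "Y \<oplus>\<^sub>W Z"] by simp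
      with x right show ?thesis by (simp add: wiring_comp_simps wiring_sum_simps wiring_braid_simps)
    qed
  qed
next
  show "?L \<in> extensional (fst (inp (X \<oplus>\<^sub>W Y \<oplus>\<^sub>W Z)) <+> fst (outp (Y \<oplus>\<^sub>W Z \<oplus>\<^sub>W X)))"
    using wiring_braid_extensional[of X "Y \<oplus>\<^sub>W Z"] by (simp add: TFS_union_assoc)
qed (rule wiring_comp_extensional)

lemma W_symmetric_monoidal_category:
  "symmetric_monoidal_category W_Obj W_Hom W_Id W_Comp
     W_sum W_sum_hom W_zero W_assoc W_unitor W_unitor W_braid"
proof -
  interpret monoidal_category W_Obj W_Hom W_Id W_Comp W_sum W_sum_hom W_zero W_assoc W_unitor W_unitor
    by (rule W_monoidal_category)
  show ?thesis
  proof (unfold_locales, goal_cases)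
    case (1 X Y)
    then show ?case by (simp add: W_braid_eq W_Hom_iff)
  next
    case (2 X Y)
    then show ?case by (simp add: W_braid_eq W_Comp_eq W_Id_eq wiring_braid_inv)
  next
    case (3 X Y X' Y' f g)
    then show ?case
      by (auto elim!: W_HomE simp: W_braid_eq W_Comp_eq W_sum_hom_eq wiring_braid_nat)
  next
    case (4 X Y Z)
    then have "W_braid X (Y \<oplus>\<^sub>W Z)
        = W_Comp (W_sum_hom (W_Id Y) (W_braid X Z)) (W_sum_hom (W_braid X Y) (W_Id Z))"
      using wiring_braid_hexagon[of X Y Z]
      by (simp add: W_braid_eq W_Id_eq W_Comp_eq W_sum_hom_eq W_sum_assoc)
    \<comment> \<open>The identities standing for associators cancel only against diagrams known to
      lie in the right hom-sets.\<close>
    moreover have "W_braid X (Y \<oplus>\<^sub>W Z) \<in> W_Hom (X \<oplus>\<^sub>W Y \<oplus>\<^sub>W Z) (Y \<oplus>\<^sub>W Z \<oplus>\<^sub>W X)"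
      "W_sum_hom (W_Id Y) (W_braid X Z) \<in> W_Hom (Y \<oplus>\<^sub>W X \<oplus>\<^sub>W Z) (Y \<oplus>\<^sub>W Z \<oplus>\<^sub>W X)"
      using 4 wiring_wiring_braid[of X "Y \<oplus>\<^sub>W Z"]
      by (simp_all add: W_braid_eq W_Id_eq W_Hom_iff W_sum_hom_eq W_sum_assoc)
    ultimately show ?case
      using 4 W.Id_left[of "X \<oplus>\<^sub>W Y \<oplus>\<^sub>W Z" "Y \<oplus>\<^sub>W Z \<oplus>\<^sub>W X"] W.Id_right[of "X \<oplus>\<^sub>W Y \<oplus>\<^sub>W Z" "Y \<oplus>\<^sub>W Z \<oplus>\<^sub>W X"]
        W.Id_right[of "Y \<oplus>\<^sub>W X \<oplus>\<^sub>W Z" "Y \<oplus>\<^sub>W Z \<oplus>\<^sub>W X"]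
      by (simp add: W_assoc_def)
  qed
qed

section \<open>Linear open systems and their blocks\<close>

lemma carrier_dprod:
  "x \<in> carrier (dprod A) \<longleftrightarrow> x \<in> extensional (fst A) \<and> (\<forall>a \<in> fst A. x a \<in> carrier_vec (snd A a))"
  by (auto simp: dprod_def PiE_iff)

lemma dprod_inI:
  "\<lbrakk>x \<in> extensional (fst A); \<And>a. a \<in> fst A \<Longrightarrow> x a \<in> carrier_vec (snd A a)\<rbrakk> \<Longrightarrow> x \<in> carrier (dprod A)"
  by (simp add: carrier_dprod)

lemma dprod_extensional: "x \<in> carrier (dprod A) \<Longrightarrow> x \<in> extensional (fst A)"
  and dprod_apply_in [simp]: "\<lbrakk>x \<in> carrier (dprod A); a \<in> fst A\<rbrakk> \<Longrightarrow> x a \<in> carrier_vec (snd A a)"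
  by (simp_all add: carrier_dprod)

lemma dprod_eqI:
  "\<lbrakk>x \<in> carrier (dprod A); y \<in> carrier (dprod A); \<And>a. a \<in> fst A \<Longrightarrow> x a = y a\<rbrakk> \<Longrightarrow> x = y"
  by (rule extensionalityI[of _ "fst A"]) (simp_all add: dprod_extensional)

lemma smult_vec_zero: "v \<in> carrier_vec n \<Longrightarrow> 0 \<cdot>\<^sub>v v = (0\<^sub>v n :: real vec)"
  by (intro eq_vecI) auto

lemma smult_zero_vec: "r \<cdot>\<^sub>v 0\<^sub>v n = (0\<^sub>v n :: real vec)"
  by (intro eq_vecI) auto

lemma zero_dprod [simp]: "a \<in> fst A \<Longrightarrow> \<zero>\<^bsub>dprod A\<^esub> a = 0\<^sub>v (snd A a)"
  and add_dprod [simp]: "a \<in> fst A \<Longrightarrow> (x \<oplus>\<^bsub>dprod A\<^esub> y) a = x a + y a"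
  and smult_dprod [simp]: "a \<in> fst A \<Longrightarrow> (c \<odot>\<^bsub>dprod A\<^esub> x) a = c \<cdot>\<^sub>v x a"
  by (simp_all add: dprod_def)

lemma zero_dprod_closed [simp]: "\<zero>\<^bsub>dprod A\<^esub> \<in> carrier (dprod A)"
  and add_dprod_closed [simp]:
    "\<lbrakk>x \<in> carrier (dprod A); y \<in> carrier (dprod A)\<rbrakk> \<Longrightarrow> x \<oplus>\<^bsub>dprod A\<^esub> y \<in> carrier (dprod A)"
  and smult_dprod_closed [simp]: "x \<in> carrier (dprod A) \<Longrightarrow> c \<odot>\<^bsub>dprod A\<^esub> x \<in> carrier (dprod A)"
  by (auto simp: dprod_def PiE_iff)

lemma zero_add_dprod [simp]: "x \<in> carrier (dprod A) \<Longrightarrow> \<zero>\<^bsub>dprod A\<^esub> \<oplus>\<^bsub>dprod A\<^esub> x = x"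
  and add_zero_dprod [simp]: "x \<in> carrier (dprod A) \<Longrightarrow> x \<oplus>\<^bsub>dprod A\<^esub> \<zero>\<^bsub>dprod A\<^esub> = x"
  by (simp_all add: dprod_eqI[of _ A])

lemma smult_0_dprod [simp]: "x \<in> carrier (dprod A) \<Longrightarrow> 0 \<odot>\<^bsub>dprod A\<^esub> x = \<zero>\<^bsub>dprod A\<^esub>"
  by (rule dprod_eqI[of _ A]) (simp_all add: smult_vec_zero[OF dprod_apply_in])

lemma add_dprod_assoc:
  assumes "x \<in> carrier (dprod A)" "y \<in> carrier (dprod A)" "z \<in> carrier (dprod A)"
  shows "(x \<oplus>\<^bsub>dprod A\<^esub> y) \<oplus>\<^bsub>dprod A\<^esub> z = x \<oplus>\<^bsub>dprod A\<^esub> (y \<oplus>\<^bsub>dprod A\<^esub> z)"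
  by (rule dprod_eqI[of _ A]) (use assms in \<open>simp_all add: assoc_add_vec[OF dprod_apply_in dprod_apply_in dprod_apply_in]\<close>)

text \<open>The medial law gives additivity both of pointwise sums of linear maps and of the map
  sending \<open>(m, u)\<close> to \<open>a m\<close> plus \<open>b u\<close>.\<close>

lemma add_dprod_add:
  assumes "x \<in> carrier (dprod A)" "y \<in> carrier (dprod A)" "z \<in> carrier (dprod A)" "w \<in> carrier (dprod A)"
  shows "(x \<oplus>\<^bsub>dprod A\<^esub> y) \<oplus>\<^bsub>dprod A\<^esub> (z \<oplus>\<^bsub>dprod A\<^esub> w)
    = (x \<oplus>\<^bsub>dprod A\<^esub> z) \<oplus>\<^bsub>dprod A\<^esub> (y \<oplus>\<^bsub>dprod A\<^esub> w)"
proof (rule dprod_eqI[of _ A])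
  fix a assume a: "a \<in> fst A"
  show "((x \<oplus>\<^bsub>dprod A\<^esub> y) \<oplus>\<^bsub>dprod A\<^esub> (z \<oplus>\<^bsub>dprod A\<^esub> w)) a
    = ((x \<oplus>\<^bsub>dprod A\<^esub> z) \<oplus>\<^bsub>dprod A\<^esub> (y \<oplus>\<^bsub>dprod A\<^esub> w)) a"
    using a by (intro eq_vecI) (simp_all add: carrier_vecD[OF assms(1)[THEN dprod_apply_in, OF a]]
      carrier_vecD[OF assms(2)[THEN dprod_apply_in, OF a]] carrier_vecD[OF assms(3)[THEN dprod_apply_in, OF a]]
      carrier_vecD[OF assms(4)[THEN dprod_apply_in, OF a]])
qed (use assms in simp_all)

lemma smult_dprod_add:
  assumes "x \<in> carrier (dprod A)" "y \<in> carrier (dprod A)"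
  shows "c \<odot>\<^bsub>dprod A\<^esub> (x \<oplus>\<^bsub>dprod A\<^esub> y) = c \<odot>\<^bsub>dprod A\<^esub> x \<oplus>\<^bsub>dprod A\<^esub> c \<odot>\<^bsub>dprod A\<^esub> y"
  by (rule dprod_eqI[of _ A]) (use assms in \<open>simp_all add: smult_add_distrib_vec[OF dprod_apply_in dprod_apply_in]\<close>)

text \<open>Unlike membership in \<open>linear_maps\<close>, this does not ask for extensionality, so that blocks can be
  written as plain functions.\<close>

definition is_linear :: "'i tfs \<Rightarrow> 'j tfs \<Rightarrow> (('i \<Rightarrow> real vec) \<Rightarrow> 'j \<Rightarrow> real vec) \<Rightarrow> bool" where
  "is_linear A B h \<longleftrightarrow>
     (\<forall>x \<in> carrier (dprod A). h x \<in> carrier (dprod B)) \<and>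
     (\<forall>x \<in> carrier (dprod A). \<forall>y \<in> carrier (dprod A). h (x \<oplus>\<^bsub>dprod A\<^esub> y) = h x \<oplus>\<^bsub>dprod B\<^esub> h y) \<and>
     (\<forall>c. \<forall>x \<in> carrier (dprod A). h (c \<odot>\<^bsub>dprod A\<^esub> x) = c \<odot>\<^bsub>dprod B\<^esub> h x)"

lemma is_linear_in: "\<lbrakk>is_linear A B h; x \<in> carrier (dprod A)\<rbrakk> \<Longrightarrow> h x \<in> carrier (dprod B)"
  and is_linear_add: "\<lbrakk>is_linear A B h; x \<in> carrier (dprod A); y \<in> carrier (dprod A)\<rbrakk>
    \<Longrightarrow> h (x \<oplus>\<^bsub>dprod A\<^esub> y) = h x \<oplus>\<^bsub>dprod B\<^esub> h y"
  and is_linear_smult: "\<lbrakk>is_linear A B h; x \<in> carrier (dprod A)\<rbrakk>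
    \<Longrightarrow> h (c \<odot>\<^bsub>dprod A\<^esub> x) = c \<odot>\<^bsub>dprod B\<^esub> h x"
  by (auto simp: is_linear_def)

text \<open>Homogeneity for the scalar \<open>0\<close> suffices, since \<open>0\<close> times any
  vector is zero.\<close>

lemma is_linear_zero: "is_linear A B h \<Longrightarrow> h \<zero>\<^bsub>dprod A\<^esub> = \<zero>\<^bsub>dprod B\<^esub>"
  using is_linear_smult[of A B h "\<zero>\<^bsub>dprod A\<^esub>" 0] is_linear_in[of A B h "\<zero>\<^bsub>dprod A\<^esub>"] by simp

lemma is_linear_compose: "\<lbrakk>is_linear A B h; is_linear B C k\<rbrakk> \<Longrightarrow> is_linear A C (\<lambda>x. k (h x))"
  by (auto simp: is_linear_def)

lemma is_linear_plus:
  "\<lbrakk>is_linear A B h; is_linear A B k\<rbrakk> \<Longrightarrow> is_linear A B (\<lambda>x. h x \<oplus>\<^bsub>dprod B\<^esub> k x)"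
  by (simp add: is_linear_def add_dprod_add smult_dprod_add)

lemma is_linear_const_zero: "is_linear A B (\<lambda>_. \<zero>\<^bsub>dprod B\<^esub>)"
  by (auto simp: is_linear_def intro!: dprod_eqI[of _ B])

text \<open>Blocks are plain functions with arbitrary values off the carriers; this rule reduces
  later equations between systems to equations between blocks on the carriers.\<close>

lemma from_blocks_cong:
  assumes "\<And>m. m \<in> carrier M \<Longrightarrow> a m = a' m" "\<And>u. u \<in> carrier U \<Longrightarrow> b u = b' u"
    "\<And>m. m \<in> carrier M \<Longrightarrow> c m = c' m"
  shows "from_blocks M U a b c = from_blocks M U a' b' c'"
  using assms by (auto simp: from_blocks_def intro!: restrict_ext)

section \<open>Systems presented by their blocks\<close>

abbreviation lsys :: "'a label tfs \<Rightarrow> 'a box \<Rightarrow> (('a label \<Rightarrow> real vec) \<Rightarrow> 'a label \<Rightarrow> real vec)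
    \<Rightarrow> (('a label \<Rightarrow> real vec) \<Rightarrow> 'a label \<Rightarrow> real vec)
    \<Rightarrow> (('a label \<Rightarrow> real vec) \<Rightarrow> 'a label \<Rightarrow> real vec) \<Rightarrow> 'a lsys" where
  "lsys S X a b c \<equiv> (S, from_blocks (dprod S) (dprod (inp X)) a b c)"

text \<open>Linear blocks serve as coordinates of a system; \<open>lsys_in\<close> and
  \<open>L_Obj_cases\<close> translate in the two directions.\<close>

definition linear_blocks :: "'a label tfs \<Rightarrow> 'a box \<Rightarrow> (('a label \<Rightarrow> real vec) \<Rightarrow> 'a label \<Rightarrow> real vec)
    \<Rightarrow> (('a label \<Rightarrow> real vec) \<Rightarrow> 'a label \<Rightarrow> real vec)
    \<Rightarrow> (('a label \<Rightarrow> real vec) \<Rightarrow> 'a label \<Rightarrow> real vec) \<Rightarrow> bool" where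
  "linear_blocks S X a b c \<longleftrightarrow> S \<in> TFS \<and> is_linear S S a \<and> is_linear (inp X) S b \<and> is_linear S (outp X) c"

lemma linear_blocksD:
  assumes "linear_blocks S X a b c"
  shows "S \<in> TFS" "is_linear S S a" "is_linear (inp X) S b" "is_linear S (outp X) c"
  using assms by (auto simp: linear_blocks_def)

lemma linear_blocks_closed:
  assumes "linear_blocks S X a b c"
  shows "m \<in> carrier (dprod S) \<Longrightarrow> a m \<in> carrier (dprod S)"
    and "u \<in> carrier (dprod (inp X)) \<Longrightarrow> b u \<in> carrier (dprod S)"
    and "m \<in> carrier (dprod S) \<Longrightarrow> c m \<in> carrier (dprod (outp X))"
  using linear_blocksD[OF assms] by (simp_all add: is_linear_def)

lemma linear_blocks_zero:
  assumes "linear_blocks S X a b c"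
  shows "a \<zero>\<^bsub>dprod S\<^esub> = \<zero>\<^bsub>dprod S\<^esub>" "b \<zero>\<^bsub>dprod (inp X)\<^esub> = \<zero>\<^bsub>dprod S\<^esub>"
    "c \<zero>\<^bsub>dprod S\<^esub> = \<zero>\<^bsub>dprod (outp X)\<^esub>"
  using assms by (auto simp: linear_blocks_def dest: is_linear_zero)

text \<open>The state and input blocks are read off with the other argument zero, where the other
  linear block vanishes.\<close>

lemma blocks_from_blocks [simp]:
  assumes "linear_blocks S X a b c"
  shows "m \<in> carrier (dprod S) \<Longrightarrow>
      block_MM (dprod S) (dprod (inp X)) (from_blocks (dprod S) (dprod (inp X)) a b c) m = a m"
    and "u \<in> carrier (dprod (inp X)) \<Longrightarrow>
      block_MU (dprod S) (dprod (inp X)) (from_blocks (dprod S) (dprod (inp X)) a b c) u = b u"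
    and "m \<in> carrier (dprod S) \<Longrightarrow> block_UM (from_blocks (dprod S) (dprod (inp X)) a b c) m = c m"
  using linear_blocks_closed[OF assms] linear_blocks_zero[OF assms]
  by (simp_all add: block_MM_def block_MU_def block_UM_def from_blocks_def)

lemma lsys_in:
  assumes "linear_blocks S X a b c"
  shows "lsys S X a b c \<in> L_Obj X"
proof -
  note lin = linear_blocksD[OF assms]
  note linear = linear_blocks_closed[OF assms] lin(1) is_linear_add[OF lin(2)] is_linear_add[OF lin(3)]
    is_linear_add[OF lin(4)] is_linear_smult[OF lin(2)] is_linear_smult[OF lin(3)] is_linear_smult[OF lin(4)]
  show ?thesis
    by (auto simp: L_Obj_def linear_open_system_def from_blocks_def linear_maps_def direct_product_def
        linear add_dprod_add smult_dprod_add PiE_iff)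
qed

text \<open>Additivity applied to \<open>(m, u) = (m, 0) + (0, u)\<close> recovers the tangent
  component from the blocks; the base-point condition fixes the first component.\<close>

lemma L_Obj_cases:
  assumes "s \<in> L_Obj X"
  obtains S a b c where "s = lsys S X a b c" "linear_blocks S X a b c"
proof -
  obtain S f where s: "s = (S, f)" by (cases s)
  let ?M = "dprod S" and ?U = "dprod (inp X)" and ?W = "dprod (outp X)"
  let ?a = "block_MM ?M ?U f" and ?b = "block_MU ?M ?U f"
  have S: "S \<in> TFS" and f1: "fst f \<in> linear_maps (?M \<times>\<^sub>V ?U) (?M \<times>\<^sub>V ?M)" and f2: "snd f \<in> linear_maps ?M ?W"
    and base: "\<And>m u. m \<in> carrier ?M \<Longrightarrow> u \<in> carrier ?U \<Longrightarrow> fst (fst f (m, u)) = m"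
    using assms by (auto simp: s L_Obj_def linear_open_system_def)
  have f1_in: "fst f (m, u) \<in> carrier ?M \<times> carrier ?M" if "m \<in> carrier ?M" "u \<in> carrier ?U" for m u
    using f1 that by (auto simp: linear_maps_def direct_product_def PiE_iff)
  have add: "snd (fst f (m \<oplus>\<^bsub>?M\<^esub> m', u \<oplus>\<^bsub>?U\<^esub> u')) = snd (fst f (m, u)) \<oplus>\<^bsub>?M\<^esub> snd (fst f (m', u'))"
    if "m \<in> carrier ?M" "u \<in> carrier ?U" "m' \<in> carrier ?M" "u' \<in> carrier ?U" for m u m' u'
    using f1 that by (force simp: linear_maps_def direct_product_def)
  have smult: "snd (fst f (r \<odot>\<^bsub>?M\<^esub> m, r \<odot>\<^bsub>?U\<^esub> u)) = r \<odot>\<^bsub>?M\<^esub> snd (fst f (m, u))"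
    if "m \<in> carrier ?M" "u \<in> carrier ?U" for r m u
    using f1 that by (force simp: linear_maps_def direct_product_def)
  \<comment> \<open>Restricting joint homogeneity to one argument leaves the other one at
    \<open>r\<close> times zero.\<close>
  have smult_zero: "r \<odot>\<^bsub>dprod A\<^esub> \<zero>\<^bsub>dprod A\<^esub> = \<zero>\<^bsub>dprod A\<^esub>" for r and A :: "'a label tfs"
    by (rule dprod_eqI[of _ A]) auto
  have snd_in: "snd (fst f (m, u)) \<in> carrier ?M" if "m \<in> carrier ?M" "u \<in> carrier ?U" for m u
    using f1_in[OF that] by auto
  have "is_linear S S ?a"
    using add[of _ "\<zero>\<^bsub>?U\<^esub>" _ "\<zero>\<^bsub>?U\<^esub>"] smult[of _ "\<zero>\<^bsub>?U\<^esub>"]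
    by (simp add: is_linear_def block_MM_def snd_in smult_zero)
  moreover have "is_linear (inp X) S ?b"
    using add[of "\<zero>\<^bsub>?M\<^esub>" _ "\<zero>\<^bsub>?M\<^esub>"] smult[of "\<zero>\<^bsub>?M\<^esub>"]
    by (simp add: is_linear_def block_MU_def snd_in smult_zero)
  moreover have "is_linear S (outp X) (snd f)"
    using f2 by (auto simp: is_linear_def linear_maps_def)
  ultimately have lin: "linear_blocks S X ?a ?b (snd f)"
    using S by (simp add: linear_blocks_def)
  have "fst f = (\<lambda>(m, u) \<in> carrier ?M \<times> carrier ?U. (m, ?a m \<oplus>\<^bsub>?M\<^esub> ?b u))"
  proof (rule extensionalityI[of _ "carrier ?M \<times> carrier ?U"])
    show "fst f \<in> extensional (carrier ?M \<times> carrier ?U)"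
      using f1 by (simp add: linear_maps_def direct_product_def PiE_iff)
    fix p assume "p \<in> carrier ?M \<times> carrier ?U"
    then obtain m u where p: "p = (m, u)" "m \<in> carrier ?M" "u \<in> carrier ?U" by auto
    show "fst f p = (\<lambda>(m, u) \<in> carrier ?M \<times> carrier ?U. (m, ?a m \<oplus>\<^bsub>?M\<^esub> ?b u)) p"
      using add[of m "\<zero>\<^bsub>?U\<^esub>" "\<zero>\<^bsub>?M\<^esub>" u] base[of m u] p(2,3)
      by (simp add: p(1) block_MM_def block_MU_def prod_eq_iff[of "fst f (m, u)"])
  qed simp
  moreover have "snd f = (\<lambda>m \<in> carrier ?M. snd f m)"
    using f2 by (simp add: linear_maps_def PiE_iff extensional_restrict)
  ultimately have "f = from_blocks ?M ?U ?a ?b (snd f)"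
    unfolding from_blocks_def by (metis prod.collapse)
  with lin show thesis using that by (simp add: s)
qed

section \<open>The blocks of a wiring as linear maps\<close>

lemma case_sum_in_dprod:
  "\<lbrakk>x \<in> carrier (dprod A); y \<in> carrier (dprod B)\<rbrakk> \<Longrightarrow> case_sum x y \<in> carrier (dprod (A +\<^sub>T B))"
  by (auto simp: carrier_dprod extensional_def split: sum.split)

text \<open>\<open>reindex\<close> is restricted to the dependent product of the sum type; once
  membership there is known, each coordinate is copied from the port that \<open>\<phi>\<close>
  names.\<close>

lemma wire_lin_apply:
  assumes "x \<in> carrier (dprod (outp X))" "y \<in> carrier (dprod (inp Y))"
  shows "fst (wire_lin (X, Y, \<phi>) (x, y))
      = (\<lambda>a \<in> fst (inp X). case \<phi> (Inl a) of Inl b \<Rightarrow> x b | Inr c \<Rightarrow> y c)"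
    and "snd (wire_lin (X, Y, \<phi>) (x, y))
      = (\<lambda>b \<in> fst (outp Y). case \<phi> (Inr b) of Inl b \<Rightarrow> x b | Inr c \<Rightarrow> y c)"
  using case_sum_in_dprod[OF assms] by (auto simp: wire_lin_def reindex_def Let_def restrict_def)

text \<open>The argument on the side of \<open>Y\<close> is zero, so a coordinate supplied from
  there is a zero vector, of the dimension recorded at its source.\<close>

lemma wire_XX_apply:
  assumes "x \<in> carrier (dprod (outp X))" "a \<in> fst (inp X)"
  shows "\<phi> (Inl a) = Inl b \<Longrightarrow> wire_XX (X, Y, \<phi>) x a = x b"
    and "\<lbrakk>\<phi> (Inl a) = Inr c; c \<in> fst (inp Y)\<rbrakk> \<Longrightarrow> wire_XX (X, Y, \<phi>) x a = 0\<^sub>v (snd (inp Y) c)"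
  using assms by (simp_all add: wire_XX_def wire_lin_apply)

lemma wire_XY_apply:
  assumes "y \<in> carrier (dprod (inp Y))" "a \<in> fst (inp X)"
  shows "\<lbrakk>\<phi> (Inl a) = Inl b; b \<in> fst (outp X)\<rbrakk> \<Longrightarrow> wire_XY (X, Y, \<phi>) y a = 0\<^sub>v (snd (outp X) b)"
    and "\<phi> (Inl a) = Inr c \<Longrightarrow> wire_XY (X, Y, \<phi>) y a = y c"
  using assms by (simp_all add: wire_XY_def wire_lin_apply)

lemma wire_YX_apply:
  assumes "x \<in> carrier (dprod (outp X))" "b \<in> fst (outp Y)" "\<phi> (Inr b) = Inl c"
  shows "wire_YX (X, Y, \<phi>) x b = x c"
  using assms by (simp add: wire_YX_def wire_lin_apply)

lemmas wire_apply = wire_XX_apply wire_XY_apply wire_YX_apply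

text \<open>Each coordinate is copied from its source or is zero, and \<open>\<phi>\<close>
  preserves types, so the dimensions match.\<close>

lemma wire_closed [simp]:
  assumes \<phi>: "wiring X Y \<phi>"
  shows "x \<in> carrier (dprod (outp X)) \<Longrightarrow> wire_XX (X, Y, \<phi>) x \<in> carrier (dprod (inp X))"
    and "y \<in> carrier (dprod (inp Y)) \<Longrightarrow> wire_XY (X, Y, \<phi>) y \<in> carrier (dprod (inp X))"
    and "x \<in> carrier (dprod (outp X)) \<Longrightarrow> wire_YX (X, Y, \<phi>) x \<in> carrier (dprod (outp Y))"
proof -
  assume x: "x \<in> carrier (dprod (outp X))"
  have "wire_XX (X, Y, \<phi>) x a \<in> carrier_vec (snd (inp X) a)" if a: "a \<in> fst (inp X)" for a
    using \<phi> a by (cases rule: wiring_in_cases)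
      (use x a in \<open>simp_all add: wire_apply, (metis dprod_apply_in)?\<close>)
  then show "wire_XX (X, Y, \<phi>) x \<in> carrier (dprod (inp X))"
    by (intro dprod_inI) (simp_all add: wire_XX_def wire_lin_apply x)
  have "wire_YX (X, Y, \<phi>) x b \<in> carrier_vec (snd (outp Y) b)" if b: "b \<in> fst (outp Y)" for b
    using \<phi> b by (cases rule: wiring_out_cases)
      (use x b in \<open>simp_all add: wire_apply, (metis dprod_apply_in)?\<close>)
  then show "wire_YX (X, Y, \<phi>) x \<in> carrier (dprod (outp Y))"
    by (intro dprod_inI) (simp_all add: wire_YX_def wire_lin_apply x)
next
  assume y: "y \<in> carrier (dprod (inp Y))"
  have "wire_XY (X, Y, \<phi>) y a \<in> carrier_vec (snd (inp X) a)" if a: "a \<in> fst (inp X)" for a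
    using \<phi> a by (cases rule: wiring_in_cases)
      (use y a in \<open>simp_all add: wire_apply, (metis dprod_apply_in)?\<close>)
  then show "wire_XY (X, Y, \<phi>) y \<in> carrier (dprod (inp X))"
    by (intro dprod_inI) (simp_all add: wire_XY_def wire_lin_apply y)
qed

text \<open>In each coordinate a block either copies one coordinate of its argument or is constantly
  zero, and both are linear.\<close>

lemma is_linear_wire:
  assumes \<phi>: "wiring X Y \<phi>"
  shows "is_linear (outp X) (inp X) (wire_XX (X, Y, \<phi>))"
    and "is_linear (inp Y) (inp X) (wire_XY (X, Y, \<phi>))"
    and "is_linear (outp X) (outp Y) (wire_YX (X, Y, \<phi>))"
proof -
  show "is_linear (outp X) (inp X) (wire_XX (X, Y, \<phi>))"
    unfolding is_linear_def
  proof (intro conjI ballI allI)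
    fix x y assume x: "x \<in> carrier (dprod (outp X))" "y \<in> carrier (dprod (outp X))"
    show "wire_XX (X, Y, \<phi>) (x \<oplus>\<^bsub>dprod (outp X)\<^esub> y)
      = wire_XX (X, Y, \<phi>) x \<oplus>\<^bsub>dprod (inp X)\<^esub> wire_XX (X, Y, \<phi>) y"
    proof (rule dprod_eqI[of _ "inp X"])
      fix a assume a: "a \<in> fst (inp X)"
      with \<phi> show "wire_XX (X, Y, \<phi>) (x \<oplus>\<^bsub>dprod (outp X)\<^esub> y) a
        = (wire_XX (X, Y, \<phi>) x \<oplus>\<^bsub>dprod (inp X)\<^esub> wire_XX (X, Y, \<phi>) y) a"
        by (cases rule: wiring_in_cases) (simp_all add: wire_apply a x)
    qed (simp_all add: x \<phi>)
  next
    fix r x assume x: "x \<in> carrier (dprod (outp X))"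
    show "wire_XX (X, Y, \<phi>) (r \<odot>\<^bsub>dprod (outp X)\<^esub> x)
      = r \<odot>\<^bsub>dprod (inp X)\<^esub> wire_XX (X, Y, \<phi>) x"
    proof (rule dprod_eqI[of _ "inp X"])
      fix a assume a: "a \<in> fst (inp X)"
      with \<phi> show "wire_XX (X, Y, \<phi>) (r \<odot>\<^bsub>dprod (outp X)\<^esub> x) a
        = (r \<odot>\<^bsub>dprod (inp X)\<^esub> wire_XX (X, Y, \<phi>) x) a"
        by (cases rule: wiring_in_cases) (simp_all add: wire_apply a x smult_zero_vec)
    qed (simp_all add: x \<phi>)
  qed (simp add: \<phi>)
  show "is_linear (inp Y) (inp X) (wire_XY (X, Y, \<phi>))"
    unfolding is_linear_def
  proof (intro conjI ballI allI)
    fix x y assume x: "x \<in> carrier (dprod (inp Y))" "y \<in> carrier (dprod (inp Y))"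
    show "wire_XY (X, Y, \<phi>) (x \<oplus>\<^bsub>dprod (inp Y)\<^esub> y)
      = wire_XY (X, Y, \<phi>) x \<oplus>\<^bsub>dprod (inp X)\<^esub> wire_XY (X, Y, \<phi>) y"
    proof (rule dprod_eqI[of _ "inp X"])
      fix a assume a: "a \<in> fst (inp X)"
      with \<phi> show "wire_XY (X, Y, \<phi>) (x \<oplus>\<^bsub>dprod (inp Y)\<^esub> y) a
        = (wire_XY (X, Y, \<phi>) x \<oplus>\<^bsub>dprod (inp X)\<^esub> wire_XY (X, Y, \<phi>) y) a"
        by (cases rule: wiring_in_cases) (simp_all add: wire_apply a x)
    qed (simp_all add: x \<phi>)
  next
    fix r x assume x: "x \<in> carrier (dprod (inp Y))"
    show "wire_XY (X, Y, \<phi>) (r \<odot>\<^bsub>dprod (inp Y)\<^esub> x)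
      = r \<odot>\<^bsub>dprod (inp X)\<^esub> wire_XY (X, Y, \<phi>) x"
    proof (rule dprod_eqI[of _ "inp X"])
      fix a assume a: "a \<in> fst (inp X)"
      with \<phi> show "wire_XY (X, Y, \<phi>) (r \<odot>\<^bsub>dprod (inp Y)\<^esub> x) a
        = (r \<odot>\<^bsub>dprod (inp X)\<^esub> wire_XY (X, Y, \<phi>) x) a"
        by (cases rule: wiring_in_cases) (simp_all add: wire_apply a x smult_zero_vec)
    qed (simp_all add: x \<phi>)
  qed (simp add: \<phi>)
  show "is_linear (outp X) (outp Y) (wire_YX (X, Y, \<phi>))"
    unfolding is_linear_def
  proof (intro conjI ballI allI)
    fix x y assume x: "x \<in> carrier (dprod (outp X))" "y \<in> carrier (dprod (outp X))"
    show "wire_YX (X, Y, \<phi>) (x \<oplus>\<^bsub>dprod (outp X)\<^esub> y)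
      = wire_YX (X, Y, \<phi>) x \<oplus>\<^bsub>dprod (outp Y)\<^esub> wire_YX (X, Y, \<phi>) y"
    proof (rule dprod_eqI[of _ "outp Y"])
      fix a assume a: "a \<in> fst (outp Y)"
      with \<phi> show "wire_YX (X, Y, \<phi>) (x \<oplus>\<^bsub>dprod (outp X)\<^esub> y) a
        = (wire_YX (X, Y, \<phi>) x \<oplus>\<^bsub>dprod (outp Y)\<^esub> wire_YX (X, Y, \<phi>) y) a"
        by (cases rule: wiring_out_cases) (simp_all add: wire_apply a x)
    qed (simp_all add: x \<phi>)
  next
    fix r x assume x: "x \<in> carrier (dprod (outp X))"
    show "wire_YX (X, Y, \<phi>) (r \<odot>\<^bsub>dprod (outp X)\<^esub> x)
      = r \<odot>\<^bsub>dprod (outp Y)\<^esub> wire_YX (X, Y, \<phi>) x"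
    proof (rule dprod_eqI[of _ "outp Y"])
      fix a assume a: "a \<in> fst (outp Y)"
      with \<phi> show "wire_YX (X, Y, \<phi>) (r \<odot>\<^bsub>dprod (outp X)\<^esub> x) a
        = (r \<odot>\<^bsub>dprod (outp Y)\<^esub> wire_YX (X, Y, \<phi>) x) a"
        by (cases rule: wiring_out_cases) (simp_all add: wire_apply a x smult_zero_vec)
    qed (simp_all add: x \<phi>)
  qed (simp add: \<phi>)
qed

section \<open>Direct sums and the blocks of wirings\<close>

text \<open>\<open>left_part\<close> and \<open>right_part\<close> are the projections, and
  \<open>glue\<close> the pairing, of the dependent product of a coproduct seen as a product of two
  spaces.\<close>

definition left_part :: "'a label tfs \<Rightarrow> ('a label \<Rightarrow> real vec) \<Rightarrow> 'a label \<Rightarrow> real vec" where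
  "left_part A x = (\<lambda>a \<in> fst A. x a)"

definition right_part :: "'a label tfs \<Rightarrow> 'a label tfs \<Rightarrow> ('a label \<Rightarrow> real vec) \<Rightarrow> 'a label \<Rightarrow> real vec" where
  "right_part A B x = (\<lambda>b \<in> fst B. x (join (fst A) (Inr b)))"

definition glue :: "'a label tfs \<Rightarrow> 'a label tfs \<Rightarrow> ('a label \<Rightarrow> real vec) \<Rightarrow> ('a label \<Rightarrow> real vec)
    \<Rightarrow> 'a label \<Rightarrow> real vec" where
  "glue A B x y = (\<lambda>c \<in> fst (A \<uplus>\<^sub>T B). case_sum x y (split (fst A) c))"

text \<open>Factoring a direct sum through projections and pairing lets linearity and associativity
  be proved for these pieces separately.\<close>

lemma direct_sum_eq:
  "direct_sum A A' B B' h h' = (\<lambda>x. glue B B' (h (left_part A x)) (h' (right_part A A' x)))"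
  by (simp add: direct_sum_def glue_def left_part_def right_part_def fun_eq_iff Let_def)

lemma left_part_apply [simp]: "a \<in> fst A \<Longrightarrow> left_part A x a = x a"
  by (simp add: left_part_def)

lemma right_part_apply [simp]: "b \<in> fst B \<Longrightarrow> right_part A B x b = x (join (fst A) (Inr b))"
  by (simp add: right_part_def)

lemma glue_left [simp]: "\<lbrakk>A \<in> TFS; a \<in> fst A\<rbrakk> \<Longrightarrow> glue A B x y a = x a"
  by (simp add: glue_def TFS_finite)

lemma glue_right [simp]: "b \<in> fst B \<Longrightarrow> glue A B x y (join (fst A) (Inr b)) = y b"
  by (simp add: glue_def)

lemma left_part_in [simp]:
  assumes "A \<in> TFS" "x \<in> carrier (dprod (A \<uplus>\<^sub>T B))"
  shows "left_part A x \<in> carrier (dprod A)"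
proof (rule dprod_inI)
  fix a assume a: "a \<in> fst A"
  then have "x a \<in> carrier_vec (snd (A \<uplus>\<^sub>T B) a)" using assms(2) by (intro dprod_apply_in) simp_all
  with a show "left_part A x a \<in> carrier_vec (snd A a)" using assms(1) by simp
qed (simp add: left_part_def)

lemma right_part_in [simp]:
  assumes "x \<in> carrier (dprod (A \<uplus>\<^sub>T B))"
  shows "right_part A B x \<in> carrier (dprod B)"
proof (rule dprod_inI)
  fix b assume b: "b \<in> fst B"
  then have "x (join (fst A) (Inr b)) \<in> carrier_vec (snd (A \<uplus>\<^sub>T B) (join (fst A) (Inr b)))"
    using assms by (intro dprod_apply_in) simp_all
  with b show "right_part A B x b \<in> carrier_vec (snd B b)" by simp
qed (simp add: right_part_def)

lemma glue_in [simp]: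
  assumes "A \<in> TFS" "x \<in> carrier (dprod A)" "y \<in> carrier (dprod B)"
  shows "glue A B x y \<in> carrier (dprod (A \<uplus>\<^sub>T B))"
proof (rule dprod_inI)
  fix c assume "c \<in> fst (A \<uplus>\<^sub>T B)"
  then show "glue A B x y c \<in> carrier_vec (snd (A \<uplus>\<^sub>T B) c)"
    by (cases rule: TFS_union_cases) (simp_all add: assms)
qed (simp add: glue_def)

lemma dprod_union_eqI:
  assumes "x \<in> carrier (dprod (A \<uplus>\<^sub>T B))" "y \<in> carrier (dprod (A \<uplus>\<^sub>T B))"
    and "\<And>a. a \<in> fst A \<Longrightarrow> x a = y a"
    and "\<And>b. b \<in> fst B \<Longrightarrow> x (join (fst A) (Inr b)) = y (join (fst A) (Inr b))"
  shows "x = y"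
proof (rule dprod_eqI[OF assms(1,2)])
  fix c assume "c \<in> fst (A \<uplus>\<^sub>T B)"
  then show "x c = y c" by (cases rule: TFS_union_cases) (simp_all add: assms)
qed

lemma left_part_glue [simp]:
  assumes "A \<in> TFS" "x \<in> carrier (dprod A)" "y \<in> carrier (dprod B)"
  shows "left_part A (glue A B x y) = x"
  by (rule dprod_eqI[of _ A]) (simp_all add: assms left_part_in[OF _ glue_in[of A _ _ B]])

lemma right_part_glue [simp]:
  assumes "A \<in> TFS" "x \<in> carrier (dprod A)" "y \<in> carrier (dprod B)"
  shows "right_part A B (glue A B x y) = y"
  by (rule dprod_eqI[of _ B]) (simp_all add: assms)

lemma left_part_linear: "A \<in> TFS \<Longrightarrow> is_linear (A \<uplus>\<^sub>T B) A (left_part A)"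
  unfolding is_linear_def by (auto simp: left_part_in[of A _ B] intro!: dprod_eqI[of _ A])

lemma right_part_linear: "is_linear (A \<uplus>\<^sub>T B) B (right_part A B)"
  unfolding is_linear_def by (auto intro!: dprod_eqI[of _ B])

lemma glue_add:
  assumes "A \<in> TFS" "x \<in> carrier (dprod A)" "x' \<in> carrier (dprod A)" "y \<in> carrier (dprod B)" "y' \<in> carrier (dprod B)"
  shows "glue A B (x \<oplus>\<^bsub>dprod A\<^esub> x') (y \<oplus>\<^bsub>dprod B\<^esub> y')
    = glue A B x y \<oplus>\<^bsub>dprod (A \<uplus>\<^sub>T B)\<^esub> glue A B x' y'"
  by (rule dprod_union_eqI[of _ A B]) (simp_all add: assms)

lemma glue_smult:
  assumes "A \<in> TFS" "x \<in> carrier (dprod A)" "y \<in> carrier (dprod B)"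
  shows "glue A B (r \<odot>\<^bsub>dprod A\<^esub> x) (r \<odot>\<^bsub>dprod B\<^esub> y) = r \<odot>\<^bsub>dprod (A \<uplus>\<^sub>T B)\<^esub> glue A B x y"
  by (rule dprod_union_eqI[of _ A B]) (simp_all add: assms)

lemma glue_linear:
  assumes "A \<in> TFS" "is_linear C A h" "is_linear C B k"
  shows "is_linear C (A \<uplus>\<^sub>T B) (\<lambda>x. glue A B (h x) (k x))"
  using assms by (simp add: is_linear_def glue_add glue_smult)

lemma direct_sum_linear:
  assumes "A \<in> TFS" "B \<in> TFS" "is_linear A B h" "is_linear A' B' h'"
  shows "is_linear (A \<uplus>\<^sub>T A') (B \<uplus>\<^sub>T B') (direct_sum A A' B B' h h')"
  unfolding direct_sum_eq
  by (intro glue_linear is_linear_compose[OF left_part_linear] is_linear_compose[OF right_part_linear] assms)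

lemma glue_assoc:
  assumes [simp]: "A \<in> TFS" "B \<in> TFS" "C \<in> TFS"
    and xyz: "x \<in> carrier (dprod A)" "y \<in> carrier (dprod B)" "z \<in> carrier (dprod C)"
  shows "glue (A \<uplus>\<^sub>T B) C (glue A B x y) z = glue A (B \<uplus>\<^sub>T C) x (glue B C y z)" (is "?l = ?r")
proof (rule dprod_union_eqI[of _ "A \<uplus>\<^sub>T B" C])
  show "?r \<in> carrier (dprod ((A \<uplus>\<^sub>T B) \<uplus>\<^sub>T C))" using xyz by (simp add: TFS_union_assoc)
  fix c assume c: "c \<in> fst (A \<uplus>\<^sub>T B)"
  then show "?l c = ?r c" by (cases rule: TFS_union_cases) (simp_all add: c)
next
  fix c assume c: "c \<in> fst C"
  \<comment> \<open>\<open>glue_right\<close> is applied as a rule, before simplification turns the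
    label into nested shifts.\<close>
  have "?l (join (fst (A \<uplus>\<^sub>T B)) (Inr c)) = z c" using c by (rule glue_right)
  then show "?l (join (fst (A \<uplus>\<^sub>T B)) (Inr c)) = ?r (join (fst (A \<uplus>\<^sub>T B)) (Inr c))"
    using c by simp
qed (simp add: xyz)

text \<open>This and the next two lemmas identify the three components of a vector under the two
  bracketings of a triple coproduct.\<close>

lemma left_part_left_part:
  "left_part A (left_part (A \<uplus>\<^sub>T B) x) = left_part A x"
  unfolding left_part_def by (auto simp: fun_eq_iff restrict_def)

lemma right_part_left_part:
  "right_part A B (left_part (A \<uplus>\<^sub>T B) x) = left_part B (right_part A (B \<uplus>\<^sub>T C) x)"
  unfolding left_part_def right_part_def by (auto simp: fun_eq_iff restrict_def)

lemma right_part_right_part: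
  "\<lbrakk>A \<in> TFS; B \<in> TFS\<rbrakk> \<Longrightarrow> right_part (A \<uplus>\<^sub>T B) C x = right_part B C (right_part A (B \<uplus>\<^sub>T C) x)"
  unfolding right_part_def by (auto simp: fun_eq_iff restrict_def)

lemma direct_sum_assoc:
  assumes [simp]: "A \<in> TFS" "B \<in> TFS" "C \<in> TFS" "A' \<in> TFS" "B' \<in> TFS" "C' \<in> TFS"
    and lin: "is_linear A A' h" "is_linear B B' k" "is_linear C C' l"
    and x: "x \<in> carrier (dprod (A \<uplus>\<^sub>T B \<uplus>\<^sub>T C))"
  shows "direct_sum (A \<uplus>\<^sub>T B) C (A' \<uplus>\<^sub>T B') C' (direct_sum A B A' B' h k) l x
    = direct_sum A (B \<uplus>\<^sub>T C) A' (B' \<uplus>\<^sub>T C') h (direct_sum B C B' C' k l) x"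
proof -
  have "right_part A (B \<uplus>\<^sub>T C) x \<in> carrier (dprod (B \<uplus>\<^sub>T C))" using x by simp
  then show ?thesis
    unfolding direct_sum_eq using x lin
    by (simp add: left_part_left_part right_part_left_part[of A B x C] right_part_right_part
        glue_assoc is_linear_in[of A A'] is_linear_in[of B B'] is_linear_in[of C C']
        left_part_in[of A x "B \<uplus>\<^sub>T C"] left_part_in[of B _ C])
qed

text \<open>An empty left summand has height zero, so labels stay unshifted and \<open>glue\<close>
  returns its second argument.\<close>

lemma direct_sum_empty_left:
  assumes "A \<in> TFS" "B \<in> TFS" "is_linear A B h" "x \<in> carrier (dprod A)"
  shows "direct_sum TFS_empty A TFS_empty B h' h x = h x"
proof -
  have "right_part TFS_empty A x = x"
    using assms by (intro dprod_eqI[of _ A]) (auto intro!: right_part_in[of x TFS_empty A, simplified])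
  then show ?thesis
    using assms is_linear_in[OF assms(3,4)]
    by (simp add: direct_sum_eq glue_def extensional_restrict[OF dprod_extensional] eta_contract_eq)
qed

lemma direct_sum_empty_right:
  assumes "A \<in> TFS" "B \<in> TFS" "is_linear A B h" "x \<in> carrier (dprod A)"
  shows "direct_sum A TFS_empty B TFS_empty h h' x = h x"
proof -
  have "left_part A x = x"
    using assms by (intro dprod_eqI[of _ A]) (auto intro!: left_part_in[of A x TFS_empty, simplified])
  moreover have "glue B TFS_empty y y' = y" if "y \<in> carrier (dprod B)" for y y'
  proof (rule extensionalityI[of _ "fst B"])
    show "glue B TFS_empty y y' \<in> extensional (fst B)" using assms(2) by (simp add: glue_def)
  qed (use assms(2) that in \<open>simp_all add: dprod_extensional\<close>)
  ultimately show ?thesis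
    using is_linear_in[OF assms(3,4)] by (simp add: direct_sum_eq)
qed

text \<open>Along each route at most one term of the feedback block can be nonzero: a direct wire is
  seen by the second term, a wire through \<open>Y\<close> by the first, a wire to an input of
  \<open>Z\<close> by neither. The sum only collects disjoint cases.\<close>

lemma wire_comp:
  assumes \<phi>: "wiring X Y \<phi>" and \<psi>: "wiring Y Z \<psi>"
  shows "x \<in> carrier (dprod (outp X)) \<Longrightarrow> wire_XX (X, Z, wiring_comp X Z \<psi> \<phi>) x
      = wire_XY (X, Y, \<phi>) (wire_XX (Y, Z, \<psi>) (wire_YX (X, Y, \<phi>) x))
        \<oplus>\<^bsub>dprod (inp X)\<^esub> wire_XX (X, Y, \<phi>) x"
    and "z \<in> carrier (dprod (inp Z)) \<Longrightarrow> wire_XY (X, Z, wiring_comp X Z \<psi> \<phi>) z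
      = wire_XY (X, Y, \<phi>) (wire_XY (Y, Z, \<psi>) z)"
    and "x \<in> carrier (dprod (outp X)) \<Longrightarrow> wire_YX (X, Z, wiring_comp X Z \<psi> \<phi>) x
      = wire_YX (Y, Z, \<psi>) (wire_YX (X, Y, \<phi>) x)"
proof -
  note \<omega> = wiring_wiring_comp[OF \<phi> \<psi>]
  {
    assume x: "x \<in> carrier (dprod (outp X))"
    show "wire_XX (X, Z, wiring_comp X Z \<psi> \<phi>) x
      = wire_XY (X, Y, \<phi>) (wire_XX (Y, Z, \<psi>) (wire_YX (X, Y, \<phi>) x))
        \<oplus>\<^bsub>dprod (inp X)\<^esub> wire_XX (X, Y, \<phi>) x" (is "?l = ?r")
    proof (rule dprod_eqI[of _ "inp X"])
      fix a assume a: "a \<in> fst (inp X)"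
      with \<phi> \<psi> show "?l a = ?r a"
      proof (cases rule: wiring_comp_in_cases)
        case (1 b)
        \<comment> \<open>The dimension of \<open>x b\<close> is what lets the zero vector be
          dropped from the sum.\<close>
        have "x b \<in> carrier_vec (snd (inp X) a)" using dprod_apply_in[OF x 1(2)] 1(3) by simp
        with 1 show ?thesis by (simp add: wire_apply a x \<phi> \<psi>)
      next
        case (2 y y' b)
        have "x b \<in> carrier_vec (snd (inp X) a)" using dprod_apply_in[OF x 2(8)] 2(9) by simp
        with 2 show ?thesis by (simp add: wire_apply a x \<phi> \<psi>)
      next
        case (3 y z)
        then show ?thesis by (simp add: wire_apply a x \<phi> \<psi>)
      qed
    qed (simp_all add: x \<phi> \<psi> \<omega>)
    show "wire_YX (X, Z, wiring_comp X Z \<psi> \<phi>) x = wire_YX (Y, Z, \<psi>) (wire_YX (X, Y, \<phi>) x)" (is "?l = ?r")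
    proof (rule dprod_eqI[of _ "outp Z"])
      fix b assume b: "b \<in> fst (outp Z)"
      with \<phi> \<psi> show "?l b = ?r b"
        by (cases rule: wiring_comp_out_cases) (simp add: wire_apply b x \<phi> \<psi>)
    qed (simp_all add: x \<phi> \<psi> \<omega>)
  next
    assume z: "z \<in> carrier (dprod (inp Z))"
    show "wire_XY (X, Z, wiring_comp X Z \<psi> \<phi>) z = wire_XY (X, Y, \<phi>) (wire_XY (Y, Z, \<psi>) z)" (is "?l = ?r")
    proof (rule dprod_eqI[of _ "inp X"])
      fix a assume a: "a \<in> fst (inp X)"
      with \<phi> \<psi> show "?l a = ?r a"
        by (cases rule: wiring_comp_in_cases) (simp_all add: wire_apply a z \<phi> \<psi>)
    qed (simp_all add: z \<phi> \<psi> \<omega>)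
  }
qed

text \<open>Under the identity every input is supplied from outside, so nothing is fed back.\<close>

lemma wire_id:
  "x \<in> carrier (dprod (outp X)) \<Longrightarrow> wire_XX (X, X, wiring_id X) x = \<zero>\<^bsub>dprod (inp X)\<^esub>"
  "y \<in> carrier (dprod (inp X)) \<Longrightarrow> wire_XY (X, X, wiring_id X) y = y"
  "x \<in> carrier (dprod (outp X)) \<Longrightarrow> wire_YX (X, X, wiring_id X) x = x"
  by (rule dprod_eqI[of _ "inp X"]; simp add: wire_apply)
    (rule dprod_eqI[of _ "inp X"] dprod_eqI[of _ "outp X"]; simp add: wire_apply)+

text \<open>No wire joins the two summands, so all three blocks are block diagonal.\<close>

lemma wire_sum:
  assumes [simp]: "X1 \<in> W_Obj" "Y1 \<in> W_Obj" "X2 \<in> W_Obj" "Y2 \<in> W_Obj"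
    and \<phi>1: "wiring X1 Y1 \<phi>1" and \<phi>2: "wiring X2 Y2 \<phi>2"
  defines "\<Phi> \<equiv> (X1 \<oplus>\<^sub>W X2, Y1 \<oplus>\<^sub>W Y2, wiring_sum X1 Y1 X2 Y2 \<phi>1 \<phi>2)"
  shows "x \<in> carrier (dprod (outp X1 \<uplus>\<^sub>T outp X2)) \<Longrightarrow> wire_XX \<Phi> x
      = direct_sum (outp X1) (outp X2) (inp X1) (inp X2) (wire_XX (X1, Y1, \<phi>1)) (wire_XX (X2, Y2, \<phi>2)) x"
    and "y \<in> carrier (dprod (inp Y1 \<uplus>\<^sub>T inp Y2)) \<Longrightarrow> wire_XY \<Phi> y
      = direct_sum (inp Y1) (inp Y2) (inp X1) (inp X2) (wire_XY (X1, Y1, \<phi>1)) (wire_XY (X2, Y2, \<phi>2)) y"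
    and "x \<in> carrier (dprod (outp X1 \<uplus>\<^sub>T outp X2)) \<Longrightarrow> wire_YX \<Phi> x
      = direct_sum (outp X1) (outp X2) (outp Y1) (outp Y2) (wire_YX (X1, Y1, \<phi>1)) (wire_YX (X2, Y2, \<phi>2)) x"
proof -
  note \<Phi> = wiring_wiring_sum[of X1 Y1 \<phi>1 X2 Y2 \<phi>2, OF _ _ \<phi>1 \<phi>2, simplified]
  note lin1 = is_linear_wire[OF \<phi>1] and lin2 = is_linear_wire[OF \<phi>2]
  {
    assume x: "x \<in> carrier (dprod (outp X1 \<uplus>\<^sub>T outp X2))"
    then have x': "x \<in> carrier (dprod (outp (X1 \<oplus>\<^sub>W X2)))" by simp
    \<comment> \<open>The second summand does not occur in the conclusion of
      \<open>left_part_in\<close>, so the instance at \<open>x\<close> is given to the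
      simplifier.\<close>
    note parts [simp] = left_part_in[OF outp_TFS x] right_part_in[OF x]
    show "wire_XX \<Phi> x = direct_sum (outp X1) (outp X2) (inp X1) (inp X2)
        (wire_XX (X1, Y1, \<phi>1)) (wire_XX (X2, Y2, \<phi>2)) x" (is "?l = ?r")
    proof (rule dprod_union_eqI)
      show "?l \<in> carrier (dprod (inp X1 \<uplus>\<^sub>T inp X2))"
        using wire_closed(1)[OF \<Phi> x'] by (simp add: \<Phi>_def)
      show "?r \<in> carrier (dprod (inp X1 \<uplus>\<^sub>T inp X2))"
        by (rule is_linear_in[OF direct_sum_linear[OF _ _ lin1(1) lin2(1)] x]) simp_all
      fix a assume a: "a \<in> fst (inp X1)"
      from \<phi>1 a show "?l a = ?r a"
        by (cases rule: wiring_in_cases)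
          (simp_all add: \<Phi>_def direct_sum_eq wire_apply wiring_sum_simps x x' a)
    next
      fix a assume a: "a \<in> fst (inp X2)"
      from \<phi>2 a show "?l (join (fst (inp X1)) (Inr a)) = ?r (join (fst (inp X1)) (Inr a))"
        by (cases rule: wiring_in_cases)
          (simp_all add: \<Phi>_def direct_sum_eq wire_apply wiring_sum_simps x x' a)
    qed
    show "wire_YX \<Phi> x = direct_sum (outp X1) (outp X2) (outp Y1) (outp Y2)
        (wire_YX (X1, Y1, \<phi>1)) (wire_YX (X2, Y2, \<phi>2)) x" (is "?l = ?r")
    proof (rule dprod_union_eqI)
      show "?l \<in> carrier (dprod (outp Y1 \<uplus>\<^sub>T outp Y2))"
        using wire_closed(3)[OF \<Phi> x'] by (simp add: \<Phi>_def)
      show "?r \<in> carrier (dprod (outp Y1 \<uplus>\<^sub>T outp Y2))"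
        by (rule is_linear_in[OF direct_sum_linear[OF _ _ lin1(3) lin2(3)] x]) simp_all
      fix b assume b: "b \<in> fst (outp Y1)"
      from \<phi>1 b show "?l b = ?r b"
        by (cases rule: wiring_out_cases)
          (simp_all add: \<Phi>_def direct_sum_eq wire_apply wiring_sum_simps x x' b)
    next
      fix b assume b: "b \<in> fst (outp Y2)"
      from \<phi>2 b show "?l (join (fst (outp Y1)) (Inr b)) = ?r (join (fst (outp Y1)) (Inr b))"
        by (cases rule: wiring_out_cases)
          (simp_all add: \<Phi>_def direct_sum_eq wire_apply wiring_sum_simps x x' b)
    qed
  next
    assume y: "y \<in> carrier (dprod (inp Y1 \<uplus>\<^sub>T inp Y2))"
    then have y': "y \<in> carrier (dprod (inp (Y1 \<oplus>\<^sub>W Y2)))" by simp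
    note parts [simp] = left_part_in[OF inp_TFS y] right_part_in[OF y]
    show "wire_XY \<Phi> y = direct_sum (inp Y1) (inp Y2) (inp X1) (inp X2)
        (wire_XY (X1, Y1, \<phi>1)) (wire_XY (X2, Y2, \<phi>2)) y" (is "?l = ?r")
    proof (rule dprod_union_eqI)
      show "?l \<in> carrier (dprod (inp X1 \<uplus>\<^sub>T inp X2))"
        using wire_closed(2)[OF \<Phi> y'] by (simp add: \<Phi>_def)
      show "?r \<in> carrier (dprod (inp X1 \<uplus>\<^sub>T inp X2))"
        by (rule is_linear_in[OF direct_sum_linear[OF _ _ lin1(2) lin2(2)] y]) simp_all
      fix a assume a: "a \<in> fst (inp X1)"
      from \<phi>1 a show "?l a = ?r a"
        by (cases rule: wiring_in_cases)
          (simp_all add: \<Phi>_def direct_sum_eq wire_apply wiring_sum_simps y y' a)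
    next
      fix a assume a: "a \<in> fst (inp X2)"
      from \<phi>2 a show "?l (join (fst (inp X1)) (Inr a)) = ?r (join (fst (inp X1)) (Inr a))"
        by (cases rule: wiring_in_cases)
          (simp_all add: \<Phi>_def direct_sum_eq wire_apply wiring_sum_simps y y' a)
    qed
  }
qed

section \<open>The algebra\<close>

text \<open>\<open>blocks_from_blocks\<close> recovers \<open>a\<close>, \<open>b\<close>,
  \<open>c\<close> on the carriers, and \<open>wire_closed\<close> keeps all arguments
  there.\<close>

lemma L_Hom_lsys:
  assumes \<phi>: "wiring X Y \<phi>" and lin: "linear_blocks S X a b c"
  shows "L_Hom (X, Y, \<phi>) (lsys S X a b c) = lsys S Y
      (\<lambda>m. b (wire_XX (X, Y, \<phi>) (c m)) \<oplus>\<^bsub>dprod S\<^esub> a m)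
      (\<lambda>y. b (wire_XY (X, Y, \<phi>) y)) (\<lambda>m. wire_YX (X, Y, \<phi>) (c m))"
  using \<phi> by (simp add: L_Hom_def Let_def)
    (intro from_blocks_cong; simp add: lin linear_blocks_closed[OF lin])

lemma L_Hom_linear:
  assumes \<phi>: "wiring X Y \<phi>" and lin: "linear_blocks S X a b c"
  shows "linear_blocks S Y
      (\<lambda>m. b (wire_XX (X, Y, \<phi>) (c m)) \<oplus>\<^bsub>dprod S\<^esub> a m)
      (\<lambda>y. b (wire_XY (X, Y, \<phi>) y)) (\<lambda>m. wire_YX (X, Y, \<phi>) (c m))"
proof -
  note w = is_linear_wire[OF \<phi>] and l = linear_blocksD[OF lin]
  show ?thesis
    unfolding linear_blocks_def
    using l is_linear_plus[OF is_linear_compose[OF is_linear_compose[OF l(4) w(1)] l(3)] l(2)]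
      is_linear_compose[OF w(2) l(3)] is_linear_compose[OF l(4) w(3)] by blast
qed

lemma L_mu_lsys:
  assumes lin: "linear_blocks S X a b c" and lin': "linear_blocks S' X' a' b' c'"
    and X: "X \<in> W_Obj"
  shows "L_mu X X' (lsys S X a b c, lsys S' X' a' b' c') = lsys (S \<uplus>\<^sub>T S') (X \<oplus>\<^sub>W X')
      (direct_sum S S' S S' a a') (direct_sum (inp X) (inp X') S S' b b')
      (direct_sum S S' (outp X) (outp X') c c')"
proof -
  have "S \<in> TFS" "inp X \<in> TFS" using linear_blocksD[OF lin] X by simp_all
  note parts = left_part_in[OF this(1)] right_part_in[of _ S S']
    left_part_in[OF this(2)] right_part_in[of _ "inp X" "inp X'"]
  show ?thesis
    unfolding L_mu_def direct_sum_eq inp_W_sum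
    by (simp, intro from_blocks_cong; simp add: lin lin' parts)
qed

lemma L_mu_linear:
  assumes "linear_blocks S X a b c" "linear_blocks S' X' a' b' c'" "X \<in> W_Obj"
  shows "linear_blocks (S \<uplus>\<^sub>T S') (X \<oplus>\<^sub>W X')
      (direct_sum S S' S S' a a') (direct_sum (inp X) (inp X') S S' b b')
      (direct_sum S S' (outp X) (outp X') c c')"
  using assms by (simp add: linear_blocks_def direct_sum_linear)

lemma L_unit_linear:
  "linear_blocks TFS_empty W_zero (\<lambda>_. \<zero>\<^bsub>dprod TFS_empty\<^esub>) (\<lambda>_. \<zero>\<^bsub>dprod TFS_empty\<^esub>)
     (\<lambda>_. \<zero>\<^bsub>dprod TFS_empty\<^esub>)"
  by (simp add: linear_blocks_def is_linear_const_zero)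

lemma L_unit_lsys:
  "L_unit = lsys TFS_empty W_zero (\<lambda>_. \<zero>\<^bsub>dprod TFS_empty\<^esub>) (\<lambda>_. \<zero>\<^bsub>dprod TFS_empty\<^esub>)
     (\<lambda>_. \<zero>\<^bsub>dprod TFS_empty\<^esub>)"
  by (simp add: L_unit_def)

lemma L_Hom_in:
  assumes "\<Phi> \<in> W_Hom X Y" "s \<in> L_Obj X"
  shows "L_Hom \<Phi> s \<in> L_Obj Y"
  using assms by (auto elim!: W_HomE L_Obj_cases simp: L_Hom_lsys intro!: lsys_in L_Hom_linear)

text \<open>The feedback block of the identity is zero and \<open>b\<close> preserves zero, so the
  state block reduces to \<open>a\<close>.\<close>

lemma L_Hom_Id:
  assumes "s \<in> L_Obj X"
  shows "L_Hom (W_Id X) s = s"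
  using assms
proof (cases rule: L_Obj_cases)
  case (1 S a b c)
  note closed = linear_blocks_closed[OF 1(2)]
  show ?thesis
    unfolding 1(1) W_Id_eq L_Hom_lsys[OF wiring_wiring_id 1(2)]
    by (simp, intro from_blocks_cong; simp add: wire_id closed linear_blocks_zero[OF 1(2)])
qed

lemma L_Hom_Comp:
  assumes "\<Phi> \<in> W_Hom X Y" "\<Psi> \<in> W_Hom Y Z" "s \<in> L_Obj X"
  shows "L_Hom (W_Comp \<Psi> \<Phi>) s = L_Hom \<Psi> (L_Hom \<Phi> s)"
proof -
  from assms obtain \<phi> \<psi> where \<Phi>: "\<Phi> = (X, Y, \<phi>)" "\<Psi> = (Y, Z, \<psi>)"
    and \<phi>: "wiring X Y \<phi>" and \<psi>: "wiring Y Z \<psi>"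
    by (auto elim!: W_HomE)
  from assms(3) obtain S a b c where s: "s = lsys S X a b c" and lin: "linear_blocks S X a b c"
    by (rule L_Obj_cases)
  note closed = linear_blocks_closed[OF lin]
  show ?thesis
    unfolding \<Phi> W_Comp_eq s L_Hom_lsys[OF wiring_wiring_comp[OF \<phi> \<psi>] lin] L_Hom_lsys[OF \<phi> lin]
      L_Hom_lsys[OF \<psi> L_Hom_linear[OF \<phi> lin]]
    \<comment> \<open>For the composite, \<open>b\<close> is applied to the two-term feedback sum.
      Additivity of \<open>b\<close> and associativity of addition give the bracketing produced by
      applying \<open>L_Hom\<close> twice.\<close>
    by (simp, intro from_blocks_cong;
        simp add: closed wire_comp[OF \<phi> \<psi>] \<phi> \<psi> is_linear_add[OF linear_blocksD(3)[OF lin]] add_dprod_assoc)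
qed

lemma L_mu_nat:
  assumes obj [simp]: "X \<in> W_Obj" "Y \<in> W_Obj" "X' \<in> W_Obj" "Y' \<in> W_Obj"
    and "\<Phi> \<in> W_Hom X X'" "\<Psi> \<in> W_Hom Y Y'" "s \<in> L_Obj X" "t \<in> L_Obj Y"
  shows "L_Hom (W_sum_hom \<Phi> \<Psi>) (L_mu X Y (s, t)) = L_mu X' Y' (L_Hom \<Phi> s, L_Hom \<Psi> t)"
proof -
  from assms obtain \<phi> \<psi> where \<Phi>: "\<Phi> = (X, X', \<phi>)" "\<Psi> = (Y, Y', \<psi>)"
    and \<phi>: "wiring X X' \<phi>" and \<psi>: "wiring Y Y' \<psi>"
    by (auto elim!: W_HomE)
  from assms(7) obtain S a b c where s: "s = lsys S X a b c" and lin: "linear_blocks S X a b c"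
    by (rule L_Obj_cases)
  from assms(8) obtain T a' b' c' where t: "t = lsys T Y a' b' c'" and lin': "linear_blocks T Y a' b' c'"
    by (rule L_Obj_cases)
  note S [simp] = linear_blocksD(1)[OF lin]
  note closed = linear_blocks_closed[OF lin] linear_blocks_closed[OF lin']
  note parts = left_part_in[OF S, of _ T] right_part_in[of _ S T]
    left_part_in[OF inp_TFS[OF obj(3)], of _ "inp Y'"] right_part_in[of _ "inp X'" "inp Y'"]
  show ?thesis
    unfolding \<Phi> s t W_sum_hom_eq L_mu_lsys[OF lin lin' obj(1)] L_Hom_lsys[OF \<phi> lin] L_Hom_lsys[OF \<psi> lin']
      L_Hom_lsys[OF wiring_wiring_sum[OF obj(1,3) \<phi> \<psi>] L_mu_linear[OF lin lin' obj(1)]]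
      L_mu_lsys[OF L_Hom_linear[OF \<phi> lin] L_Hom_linear[OF \<psi> lin'] obj(3)]
    \<comment> \<open>Projections cancel the intermediate pairings, and \<open>glue_add\<close>
      distributes the outer pairing over the sum of feedback and internal dynamics.\<close>
    by (simp, intro from_blocks_cong;
        simp add: wire_sum[OF obj(1,3,2,4) \<phi> \<psi>] direct_sum_eq glue_add closed parts \<phi> \<psi>)
qed

lemma L_mu_in:
  assumes "X \<in> W_Obj" "Y \<in> W_Obj" "s \<in> L_Obj X" "t \<in> L_Obj Y"
  shows "L_mu X Y (s, t) \<in> L_Obj (X \<oplus>\<^sub>W Y)"
  using assms by (auto elim!: L_Obj_cases simp: L_mu_lsys simp del: inp_W_sum intro!: lsys_in L_mu_linear)

text \<open>Strict associativity of boxes and of state sets puts both sides on the same spaces,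
  where \<open>direct_sum_assoc\<close> compares the blocks.\<close>

lemma L_mu_assoc:
  assumes obj [simp]: "X \<in> W_Obj" "Y \<in> W_Obj" "Z \<in> W_Obj"
    and "s \<in> L_Obj X" "t \<in> L_Obj Y" "u \<in> L_Obj Z"
  shows "L_mu (X \<oplus>\<^sub>W Y) Z (L_mu X Y (s, t), u) = L_mu X (Y \<oplus>\<^sub>W Z) (s, L_mu Y Z (t, u))"
proof -
  from assms(4) obtain S a b c where s: "s = lsys S X a b c" and lin: "linear_blocks S X a b c"
    by (rule L_Obj_cases)
  from assms(5) obtain T a' b' c' where t: "t = lsys T Y a' b' c'" and lin': "linear_blocks T Y a' b' c'"
    by (rule L_Obj_cases)
  from assms(6) obtain V a'' b'' c'' where u: "u = lsys V Z a'' b'' c''"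
    and lin'': "linear_blocks V Z a'' b'' c''"
    by (rule L_Obj_cases)
  note l = linear_blocksD[OF lin] and l' = linear_blocksD[OF lin'] and l'' = linear_blocksD[OF lin'']
  show ?thesis
    unfolding s t u L_mu_lsys[OF lin lin' obj(1)] L_mu_lsys[OF lin' lin'' obj(2)]
      L_mu_lsys[OF L_mu_linear[OF lin lin' obj(1)] lin'' W_sum_in[OF obj(1,2)]]
      L_mu_lsys[OF lin L_mu_linear[OF lin' lin'' obj(2)] obj(1)]
      W_sum_assoc[OF obj] TFS_union_assoc[OF l(1) l'(1) l''(1)]
    by (simp, intro from_blocks_cong; simp add: direct_sum_assoc l l' l'')
qed

lemma L_mu_unit_left:
  assumes [simp]: "X \<in> W_Obj" and "s \<in> L_Obj X"
  shows "L_mu W_zero X (L_unit, s) = s"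
proof -
  from assms(2) obtain S a b c where s: "s = lsys S X a b c" and lin: "linear_blocks S X a b c"
    by (rule L_Obj_cases)
  note l = linear_blocksD[OF lin]
  show ?thesis
    unfolding s L_unit_lsys L_mu_lsys[OF L_unit_linear lin W_zero_in]
    \<comment> \<open>A separate unfolding, because the left side of the preceding
      \<open>L_mu_lsys\<close> instance still mentions \<open>inp W_zero\<close>.\<close>
    unfolding W_sum_zero(1)[OF assms(1)]
      TFS_union_empty_left[OF l(1)] inp_W_zero outp_W_zero
    by (simp, intro from_blocks_cong; simp add: direct_sum_empty_left l)
qed

lemma L_mu_unit_right:
  assumes [simp]: "X \<in> W_Obj" and "s \<in> L_Obj X"
  shows "L_mu X W_zero (s, L_unit) = s"
proof -
  from assms(2) obtain S a b c where s: "s = lsys S X a b c" and lin: "linear_blocks S X a b c"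
    by (rule L_Obj_cases)
  note l = linear_blocksD[OF lin]
  show ?thesis
    unfolding s L_unit_lsys L_mu_lsys[OF lin L_unit_linear assms(1)]
    unfolding W_sum_zero(2)[OF assms(1)]
      TFS_union_empty_right[OF l(1)] inp_W_zero outp_W_zero
    by (simp, intro from_blocks_cong; simp add: direct_sum_empty_right l)
qed

theorem proposition5p4:
  "monoidal_algebra
     (W_Obj :: 'a box set) W_Hom W_Id W_Comp
     W_sum W_sum_hom W_zero W_assoc W_unitor W_unitor W_braid
     L_Obj L_Hom L_mu L_unit"
proof -
  interpret symmetric_monoidal_category "W_Obj :: 'a box set" W_Hom W_Id W_Comp
      W_sum W_sum_hom W_zero W_assoc W_unitor W_unitor W_braid
    by (rule W_symmetric_monoidal_category)
  show ?thesis
  proof (unfold_locales, goal_cases)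
    case 5
    show ?case unfolding L_unit_lsys by (rule lsys_in[OF L_unit_linear])
  next
    case (7 X Y Z s t u)
    then show ?case
      \<comment> \<open>The associator is an identity diagram, so it fixes the combined system once
        that is known to lie over the right-bracketed box.\<close>
      using L_mu_in[of X "Y \<oplus>\<^sub>W Z" s "L_mu Y Z (t, u)"]
      by (simp add: L_mu_assoc W_assoc_def L_Hom_Id L_mu_in)
  qed (auto simp: L_Hom_in L_Hom_Id L_Hom_Comp L_mu_in L_mu_nat W_unitor_def L_mu_unit_left L_mu_unit_right)
qed

end
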